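(* Let $(M^{2n+1},\theta,\xi,\eta,g)$ be a nearly cosymplectic manifold. Then for any $X,Y,Z$ and $W$ in $TM$ (tangent at the same point), $$R(W,X,Y,Z)-R(\theta W,\theta X,\theta Y,\theta Z)=\tfrac13\big[A(W,X,Y,Z)-B(W,X,Y,Z)\big],$$ where \begin{align*} A(W,X,Y,Z)&=\tfrac12\big[T(W+Y,Z+X)-T(W+Y,X)+T(W,X)+T(Y,X)\\ &\quad-T(W,Z+X)-T(W+Y,Z)+T(W,Z)+T(Y,Z)-T(Y,Z+X)\big], \end{align*} \begin{align*} B(W,X,Y,Z)&=\tfrac12\big[T(W+Z,X+Y)-T(W,X+Y)-T(Z,X+Y)-T(W+Z,X)\\ &\quad+T(W,X)+T(Z,X)-T(W+Z,Y)+T(W,Y)+T(Z,Y)\big] \end{align*} and \begin{align*} T(X,Y)&=-2g(Y,\xi)\,g(\theta(\nabla_X\theta)(Y),\nabla_X\xi)+2g(X,\xi)\,g(\theta(\nabla_X\theta)(Y),\nabla_Y\xi)\\ &\quad-2g(X,\xi)g(Y,\xi)\,g(\nabla_X\xi,\nabla_Y\xi)+g(Y,\xi)^2|\nabla_X\xi|^2+g(X,\xi)^2|\nabla_Y\xi|^2\\ &\quad+g(Y,\xi)R(\theta X,\theta Y,X,\xi)-g(X,\xi)R(\theta X,\theta Y,Y,\xi). \end{align*}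
   Context: An almost contact (metric) structure on a Riemannian manifold $(M^{2n+1},g)$ consists of a $(1,1)$-tensor $\theta$, a 1-form $\eta$ and a unit vector field $\xi$ with $\theta^2=-\mathrm{Id}+\eta\otimes\xi$, $\eta(\xi)=1$, compatible with the metric: $g(\theta X,\theta Y)=g(X,Y)-\eta(X)\eta(Y)$ (so $\eta=g(\xi,\cdot)$, $\theta\xi=0$ and $\theta$ is skew-symmetric). It is nearly cosymplectic, and $(M,\theta,\xi,\eta,g)$ is a nearly cosymplectic manifold, if $(\nabla_X\theta)(Y)+(\nabla_Y\theta)(X)=0$ for all $X,Y$, where $\nabla$ is the Levi-Civita connection of $g$. The curvature conventions are $R(X,Y)=[\nabla_X,\nabla_Y]-\nabla_{[X,Y]}$ and $R(X,Y,Z,W)=g(R(X,Y)Z,W)$. *)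

theory Defs
  imports "HOL-Analysis.Analysis" "HOL-Library.Function_Algebras"
begin

primrec Ck_on :: "nat \<Rightarrow> 'e::real_normed_vector set \<Rightarrow> ('e \<Rightarrow> 'f::real_normed_vector) \<Rightarrow> bool" where
  "Ck_on 0 S f \<longleftrightarrow> continuous_on S f"
| "Ck_on (Suc k) S f \<longleftrightarrow>
     (\<forall>x\<in>S. f differentiable (at x)) \<and> (\<forall>v. Ck_on k S (\<lambda>x. frechet_derivative f (at x) v))"

text \<open>Only used for open sets \<open>S\<close> in finite-dimensional spaces.\<close>

definition smooth_on :: "'e::real_normed_vector set \<Rightarrow> ('e \<Rightarrow> 'f::real_normed_vector) \<Rightarrow> bool" where
  "smooth_on S f \<longleftrightarrow> (\<forall>k. Ck_on k S f)"

type_synonym ('a, 'e) chart = "'a set \<times> ('a \<Rightarrow> 'e)"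

text \<open>The manifold is the whole type \<open>'a\<close>, with the topology of its type class; the smooth
  structure is the one generated by the atlas. The dimension is that of the model space \<open>'e\<close>.\<close>

locale smooth_manifold =
  fixes \<A> :: "('a::{t2_space, second_countable_topology}, 'e::euclidean_space) chart set"
  assumes covering: "(\<Union>(U, \<phi>)\<in>\<A>. U) = UNIV"
    and chart: "(U, \<phi>) \<in> \<A> \<Longrightarrow>
      open U \<and> open (\<phi> ` U) \<and> homeomorphism U (\<phi> ` U) \<phi> (inv_into U \<phi>)"
    and transition: "(U, \<phi>) \<in> \<A> \<Longrightarrow> (V, \<psi>) \<in> \<A> \<Longrightarrow>
      smooth_on (\<phi> ` (U \<inter> V)) (\<psi> \<circ> inv_into U \<phi>)"

definition smooth_functions :: "('a, 'e::euclidean_space) chart set \<Rightarrow> ('a \<Rightarrow> real) set" where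
  "smooth_functions \<A> = {f. \<forall>(U, \<phi>)\<in>\<A>. smooth_on (\<phi> ` U) (f \<circ> inv_into U \<phi>)}"

text \<open>A tangent vector is a directional derivative in some chart, viewed as an operator on smooth
  functions. It is set to \<open>0\<close> on non-smooth functions so that equality of operators is equality of
  tangent vectors. Addition and subtraction of tangent vectors (and of vector fields) are the
  pointwise operations on functions.\<close>

type_synonym 'a tvec = "('a \<Rightarrow> real) \<Rightarrow> real"

type_synonym 'a vfield = "'a \<Rightarrow> 'a tvec"

definition directional_derivative ::
    "('a, 'e::euclidean_space) chart set \<Rightarrow> ('a, 'e) chart \<Rightarrow> 'a \<Rightarrow> 'e \<Rightarrow> 'a tvec" where
  "directional_derivative \<A> = (\<lambda>(U, \<phi>) p u f.
     if f \<in> smooth_functions \<A> then frechet_derivative (f \<circ> inv_into U \<phi>) (at (\<phi> p)) u else 0)"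

definition tangent_space :: "('a, 'e::euclidean_space) chart set \<Rightarrow> 'a \<Rightarrow> 'a tvec set" where
  "tangent_space \<A> p = {directional_derivative \<A> c p u | c u. c \<in> \<A> \<and> p \<in> fst c}"

definition scale :: "real \<Rightarrow> 'a tvec \<Rightarrow> 'a tvec" where
  "scale c v = (\<lambda>f. c * v f)"

definition vector_fields :: "('a, 'e::euclidean_space) chart set \<Rightarrow> 'a vfield set" where
  "vector_fields \<A> = {X. (\<forall>p. X p \<in> tangent_space \<A> p) \<and>
     (\<forall>f\<in>smooth_functions \<A>. (\<lambda>p. X p f) \<in> smooth_functions \<A>)}"

definition lie_bracket :: "'a vfield \<Rightarrow> 'a vfield \<Rightarrow> 'a vfield" where
  "lie_bracket X Y = (\<lambda>p f. X p (\<lambda>q. Y q f) - Y p (\<lambda>q. X q f))"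

locale riemannian_manifold = smooth_manifold \<A>
  for \<A> :: "('a::{t2_space, second_countable_topology}, 'e::euclidean_space) chart set" +
  fixes g :: "'a \<Rightarrow> 'a tvec \<Rightarrow> 'a tvec \<Rightarrow> real"
  assumes g_sym: "\<lbrakk>v \<in> tangent_space \<A> p; w \<in> tangent_space \<A> p\<rbrakk> \<Longrightarrow> g p v w = g p w v"
    and g_add: "\<lbrakk>u \<in> tangent_space \<A> p; v \<in> tangent_space \<A> p; w \<in> tangent_space \<A> p\<rbrakk>
      \<Longrightarrow> g p (u + v) w = g p u w + g p v w"
    and g_scale: "\<lbrakk>v \<in> tangent_space \<A> p; w \<in> tangent_space \<A> p\<rbrakk>
      \<Longrightarrow> g p (scale c v) w = c * g p v w"
    and g_pos: "\<lbrakk>v \<in> tangent_space \<A> p; v \<noteq> 0\<rbrakk> \<Longrightarrow> g p v v > 0"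
    and g_smooth: "\<lbrakk>X \<in> vector_fields \<A>; Y \<in> vector_fields \<A>\<rbrakk>
      \<Longrightarrow> (\<lambda>p. g p (X p) (Y p)) \<in> smooth_functions \<A>"

text \<open>For \<open>v\<close> tangent at \<open>p\<close> and a vector field \<open>Y\<close>, \<open>nabla p v Y\<close> is the tangent vector
  \<open>\<nabla>\<^sub>v Y\<close> at \<open>p\<close>. The axioms determine \<open>nabla\<close> uniquely on these arguments, so the connection can be
  a parameter.\<close>

locale levi_civita = riemannian_manifold \<A> g
  for \<A> :: "('a::{t2_space, second_countable_topology}, 'e::euclidean_space) chart set" and g +
  fixes nabla :: "'a \<Rightarrow> 'a tvec \<Rightarrow> 'a vfield \<Rightarrow> 'a tvec"
  assumes nabla_tangent: "\<lbrakk>v \<in> tangent_space \<A> p; Y \<in> vector_fields \<A>\<rbrakk>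
      \<Longrightarrow> nabla p v Y \<in> tangent_space \<A> p"
    and nabla_smooth: "\<lbrakk>X \<in> vector_fields \<A>; Y \<in> vector_fields \<A>\<rbrakk>
      \<Longrightarrow> (\<lambda>p. nabla p (X p) Y) \<in> vector_fields \<A>"
    and nabla_add_left:
      "\<lbrakk>u \<in> tangent_space \<A> p; v \<in> tangent_space \<A> p; Y \<in> vector_fields \<A>\<rbrakk>
      \<Longrightarrow> nabla p (u + v) Y = nabla p u Y + nabla p v Y"
    and nabla_scale_left: "\<lbrakk>v \<in> tangent_space \<A> p; Y \<in> vector_fields \<A>\<rbrakk>
      \<Longrightarrow> nabla p (scale c v) Y = scale c (nabla p v Y)"
    and nabla_add_right:
      "\<lbrakk>v \<in> tangent_space \<A> p; Y \<in> vector_fields \<A>; Z \<in> vector_fields \<A>\<rbrakk>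
      \<Longrightarrow> nabla p v (Y + Z) = nabla p v Y + nabla p v Z"
    and nabla_Leibniz:
      "\<lbrakk>v \<in> tangent_space \<A> p; f \<in> smooth_functions \<A>; Y \<in> vector_fields \<A>\<rbrakk>
      \<Longrightarrow> nabla p v (\<lambda>q. scale (f q) (Y q)) = scale (v f) (Y p) + scale (f p) (nabla p v Y)"
    and nabla_metric:
      "\<lbrakk>v \<in> tangent_space \<A> p; Y \<in> vector_fields \<A>; Z \<in> vector_fields \<A>\<rbrakk>
      \<Longrightarrow> v (\<lambda>q. g q (Y q) (Z q)) = g p (nabla p v Y) (Z p) + g p (Y p) (nabla p v Z)"
    and nabla_torsion_free: "\<lbrakk>X \<in> vector_fields \<A>; Y \<in> vector_fields \<A>\<rbrakk>
      \<Longrightarrow> nabla p (X p) Y - nabla p (Y p) X = lie_bracket X Y p"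

text \<open>Tensors are evaluated at tangent vectors by extending these to vector fields; the values do
  not depend on the extension.\<close>

definition extend :: "('a, 'e::euclidean_space) chart set \<Rightarrow> 'a \<Rightarrow> 'a tvec \<Rightarrow> 'a vfield" where
  "extend \<A> p v = (SOME X. X \<in> vector_fields \<A> \<and> X p = v)"

definition curvature_field ::
    "('a \<Rightarrow> 'a tvec \<Rightarrow> 'a vfield \<Rightarrow> 'a tvec) \<Rightarrow> 'a vfield \<Rightarrow> 'a vfield \<Rightarrow> 'a vfield \<Rightarrow> 'a vfield" where
  "curvature_field nabla X Y Z = (\<lambda>p.
     nabla p (X p) (\<lambda>q. nabla q (Y q) Z) - nabla p (Y p) (\<lambda>q. nabla q (X q) Z)
     - nabla p (lie_bracket X Y p) Z)"

definition curvature ::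
    "('a, 'e::euclidean_space) chart set \<Rightarrow> ('a \<Rightarrow> 'a tvec \<Rightarrow> 'a tvec \<Rightarrow> real)
     \<Rightarrow> ('a \<Rightarrow> 'a tvec \<Rightarrow> 'a vfield \<Rightarrow> 'a tvec)
     \<Rightarrow> 'a \<Rightarrow> 'a tvec \<Rightarrow> 'a tvec \<Rightarrow> 'a tvec \<Rightarrow> 'a tvec \<Rightarrow> real" where
  "curvature \<A> g nabla p x y z w =
     g p (curvature_field nabla (extend \<A> p x) (extend \<A> p y) (extend \<A> p z) p) w"

text \<open>\<open>(\<nabla>\<^sub>v \<theta>)(w) = \<nabla>\<^sub>v (\<theta> W) - \<theta> (\<nabla>\<^sub>v W)\<close> for a vector field \<open>W\<close> extending \<open>w\<close>.\<close>

definition nabla_endo ::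
    "('a, 'e::euclidean_space) chart set \<Rightarrow> ('a \<Rightarrow> 'a tvec \<Rightarrow> 'a vfield \<Rightarrow> 'a tvec)
     \<Rightarrow> ('a \<Rightarrow> 'a tvec \<Rightarrow> 'a tvec) \<Rightarrow> 'a \<Rightarrow> 'a tvec \<Rightarrow> 'a tvec \<Rightarrow> 'a tvec" where
  "nabla_endo \<A> nabla \<theta> p v w =
     nabla p v (\<lambda>q. \<theta> q (extend \<A> p w q)) - \<theta> p (nabla p v (extend \<A> p w))"

locale almost_contact_metric_manifold = riemannian_manifold \<A> g
  for \<A> :: "('a::{t2_space, second_countable_topology}, 'e::euclidean_space) chart set" and g +
  fixes \<theta> :: "'a \<Rightarrow> 'a tvec \<Rightarrow> 'a tvec" and \<xi> :: "'a vfield" and \<eta> :: "'a \<Rightarrow> 'a tvec \<Rightarrow> real"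
  assumes theta_tangent: "v \<in> tangent_space \<A> p \<Longrightarrow> \<theta> p v \<in> tangent_space \<A> p"
    and theta_add: "\<lbrakk>v \<in> tangent_space \<A> p; w \<in> tangent_space \<A> p\<rbrakk>
      \<Longrightarrow> \<theta> p (v + w) = \<theta> p v + \<theta> p w"
    and theta_scale: "v \<in> tangent_space \<A> p \<Longrightarrow> \<theta> p (scale c v) = scale c (\<theta> p v)"
    and theta_smooth: "X \<in> vector_fields \<A> \<Longrightarrow> (\<lambda>p. \<theta> p (X p)) \<in> vector_fields \<A>"
    and eta_add: "\<lbrakk>v \<in> tangent_space \<A> p; w \<in> tangent_space \<A> p\<rbrakk>
      \<Longrightarrow> \<eta> p (v + w) = \<eta> p v + \<eta> p w"
    and eta_scale: "v \<in> tangent_space \<A> p \<Longrightarrow> \<eta> p (scale c v) = c * \<eta> p v"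
    and eta_smooth: "X \<in> vector_fields \<A> \<Longrightarrow> (\<lambda>p. \<eta> p (X p)) \<in> smooth_functions \<A>"
    and xi_field: "\<xi> \<in> vector_fields \<A>"
    and xi_unit: "g p (\<xi> p) (\<xi> p) = 1"
    and theta_square: "v \<in> tangent_space \<A> p \<Longrightarrow> \<theta> p (\<theta> p v) = - v + scale (\<eta> p v) (\<xi> p)"
    and eta_xi: "\<eta> p (\<xi> p) = 1"
    and compatible: "\<lbrakk>v \<in> tangent_space \<A> p; w \<in> tangent_space \<A> p\<rbrakk>
      \<Longrightarrow> g p (\<theta> p v) (\<theta> p w) = g p v w - \<eta> p v * \<eta> p w"

locale nearly_cosymplectic_manifold =
  almost_contact_metric_manifold \<A> g \<theta> \<xi> \<eta> + levi_civita \<A> g nabla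
  for \<A> :: "('a::{t2_space, second_countable_topology}, 'e::euclidean_space) chart set"
    and g \<theta> \<xi> \<eta> nabla +
  assumes nearly_cosymplectic: "\<lbrakk>v \<in> tangent_space \<A> p; w \<in> tangent_space \<A> p\<rbrakk>
      \<Longrightarrow> nabla_endo \<A> nabla \<theta> p v w + nabla_endo \<A> nabla \<theta> p w v = 0"

definition expr_T ::
    "('a, 'e::euclidean_space) chart set \<Rightarrow> ('a \<Rightarrow> 'a tvec \<Rightarrow> 'a tvec \<Rightarrow> real)
     \<Rightarrow> ('a \<Rightarrow> 'a tvec \<Rightarrow> 'a tvec) \<Rightarrow> 'a vfield \<Rightarrow> ('a \<Rightarrow> 'a tvec \<Rightarrow> 'a vfield \<Rightarrow> 'a tvec)
     \<Rightarrow> 'a \<Rightarrow> 'a tvec \<Rightarrow> 'a tvec \<Rightarrow> real" where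
  "expr_T \<A> g \<theta> \<xi> nabla p x y =
     - 2 * g p y (\<xi> p) * g p (\<theta> p (nabla_endo \<A> nabla \<theta> p x y)) (nabla p x \<xi>)
     + 2 * g p x (\<xi> p) * g p (\<theta> p (nabla_endo \<A> nabla \<theta> p x y)) (nabla p y \<xi>)
     - 2 * g p x (\<xi> p) * g p y (\<xi> p) * g p (nabla p x \<xi>) (nabla p y \<xi>)
     + (g p y (\<xi> p))\<^sup>2 * g p (nabla p x \<xi>) (nabla p x \<xi>)
     + (g p x (\<xi> p))\<^sup>2 * g p (nabla p y \<xi>) (nabla p y \<xi>)
     + g p y (\<xi> p) * curvature \<A> g nabla p (\<theta> p x) (\<theta> p y) x (\<xi> p)
     - g p x (\<xi> p) * curvature \<A> g nabla p (\<theta> p x) (\<theta> p y) y (\<xi> p)"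

definition expr_A :: "('v::plus \<Rightarrow> 'v \<Rightarrow> real) \<Rightarrow> 'v \<Rightarrow> 'v \<Rightarrow> 'v \<Rightarrow> 'v \<Rightarrow> real" where
  "expr_A T w x y z = 1/2 * (T (w + y) (z + x) - T (w + y) x + T w x + T y x
     - T w (z + x) - T (w + y) z + T w z + T y z - T y (z + x))"

definition expr_B :: "('v::plus \<Rightarrow> 'v \<Rightarrow> real) \<Rightarrow> 'v \<Rightarrow> 'v \<Rightarrow> 'v \<Rightarrow> 'v \<Rightarrow> real" where
  "expr_B T w x y z = 1/2 * (T (w + z) (x + y) - T w (x + y) - T z (x + y) - T (w + z) x
     + T w x + T z x - T (w + z) y + T w y + T z y)"

end

theory Submission
  imports Defs
begin

text \<open>
  Put \<open>K(W,X,Y,Z) = R(W,X,Y,Z) - R(\<theta>W,\<theta>X,\<theta>Y,\<theta>Z)\<close>. As \<open>\<theta>\<close> is linear, \<open>K\<close> has the symmetries of a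
  curvature tensor, so it is determined by its values \<open>K(X,Y,X,Y)\<close>: expanding the polarizations \<open>A\<close>
  and \<open>B\<close> and using the Bianchi identity gives \<open>A - B = 3K\<close> once \<open>K(X,Y,X,Y) = T(X,Y)\<close>. For the
  latter, write \<open>hX = \<nabla>\<^sub>X\<xi>\<close>; near-cosymplecticity makes \<open>h\<close> skew and anticommuting with \<open>\<theta>\<close>. As in
  the nearly Kaehler case, the Ricci identity for \<open>\<theta>\<close> yields
  \<open>R(X,Y,X,Y) - R(X,Y,\<theta>X,\<theta>Y) = - |(\<nabla>\<^sub>X\<theta>)Y|\<^sup>2 - g(hX,Y)\<^sup>2\<close>, where the terms in \<open>\<nabla>h\<close> cancel against
  \<open>R(X,Y,X,\<xi>)\<close> because \<open>\<xi>\<close> is Killing. Subtracting the same identity for \<open>\<theta>X, \<theta>Y\<close> gives \<open>T\<close>.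
\<close>

section \<open>Smooth functions on Euclidean spaces\<close>

text \<open>The foundational obstacle is that tensors at a point are evaluated through the arbitrary
  choice \<open>extend\<close>, while vector fields must live on the whole manifold. Much of the
  text therefore builds global fields from a bump function in one chart, to show that extensions
  exist and that the chosen one does not matter. In the geometric part the second covariant
  derivative of \<theta> is never introduced. Evaluating the Ricci identity on X, Y, X leaves one
  second-order term, because (\<nabla>_X \<theta>)X = 0, and that term is needed only in its product
  with \<theta>Y. Differentiating g((\<nabla>_X \<theta>)Y, \<theta>Y) = - g(Y,\<xi>) g(Y,hX) along
  X supplies this product. T measures the failure of \<theta> to be a complex structure: passing
  from (X,Y) to (\<theta>X,\<theta>Y) changes \<theta>^2 = - Id and the value of \<nabla>\<theta>
  (up to sign) only by \<xi>-terms, so every term of T carries a factor g(X,\<xi>) or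
  g(Y,\<xi>).\<close>

lemma Ck_on_cong:
  assumes "open S" "\<And>x. x \<in> S \<Longrightarrow> f x = g x" "Ck_on k S f"
  shows "Ck_on k S g"
  using assms(2,3)
proof (induction k arbitrary: f g)
  case 0
  then show ?case by (auto cong: continuous_on_cong)
next
  case (Suc k)
  have d: "f differentiable (at x)" if "x \<in> S" for x
    using Suc.prems(2) that by simp
  have "g differentiable (at x)" if "x \<in> S" for x
    using d[OF that] Suc.prems(1) \<open>open S\<close> that
    unfolding differentiable_def by (metis has_derivative_transform_within_open)
  moreover have "frechet_derivative f (at x) = frechet_derivative g (at x)" if "x \<in> S" for x
    using frechet_derivative_transform_within_open[OF d[OF that] \<open>open S\<close> that] Suc.prems(1) by blast
  then have "Ck_on k S (\<lambda>x. frechet_derivative g (at x) v)" for v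
    using Suc.IH[of "\<lambda>x. frechet_derivative f (at x) v" "\<lambda>x. frechet_derivative g (at x) v"]
      Suc.prems(2) by simp
  ultimately show ?case by simp
qed

lemma Ck_on_subset: "Ck_on k S f \<Longrightarrow> T \<subseteq> S \<Longrightarrow> Ck_on k T f"
  by (induction k arbitrary: f) (auto intro: continuous_on_subset)

lemma Ck_on_imp_continuous_on: "Ck_on k S f \<Longrightarrow> continuous_on S f"
  by (cases k) (auto intro!: differentiable_imp_continuous_on simp: differentiable_at_withinI
      differentiable_on_def)

lemma Ck_on_lower: "Ck_on (Suc k) S f \<Longrightarrow> Ck_on k S f"
proof (induction k arbitrary: f)
  case 0
  then show ?case using Ck_on_imp_continuous_on[of "Suc 0"] by (metis Ck_on.simps(1))
next
  case (Suc k)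
  have "Ck_on k S (\<lambda>x. frechet_derivative f (at x) v)" for v
    by (rule Suc.IH) (use Suc.prems in \<open>simp only: Ck_on.simps(2)[of "Suc k"]\<close>)
  then show ?case
    using Suc.prems by simp
qed

lemma Ck_on_Un:
  "open S \<Longrightarrow> open T \<Longrightarrow> Ck_on k S f \<Longrightarrow> Ck_on k T f \<Longrightarrow> Ck_on k (S \<union> T) f"
  by (induction k arbitrary: f) (auto intro: continuous_on_open_Un)

text \<open>The derivative may be supplied in closed form, as the rules of calculus produce it;
  openness of \<open>S\<close> carries the agreement with \<open>frechet_derivative\<close> over to
  all higher orders.\<close>

lemma Ck_on_SucI:
  assumes "open S" "\<And>x. x \<in> S \<Longrightarrow> (f has_derivative f' x) (at x)"
    and "\<And>v. Ck_on k S (\<lambda>x. f' x v)"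
  shows "Ck_on (Suc k) S f"
proof -
  have "frechet_derivative f (at x) = f' x" if "x \<in> S" for x
    using assms(2)[OF that] frechet_derivative_at by metis
  then have "Ck_on k S (\<lambda>x. frechet_derivative f (at x) v)" for v
    by (intro Ck_on_cong[OF assms(1) _ assms(3)[of v]]) simp
  then show ?thesis
    using assms(2) by (auto simp: differentiable_def)
qed

lemma Ck_on_SucD:
  assumes "Ck_on (Suc k) S f" "x \<in> S"
  shows "(f has_derivative frechet_derivative f (at x)) (at x)"
  using assms frechet_derivative_works by auto

lemma Ck_on_const: "open S \<Longrightarrow> Ck_on k S (\<lambda>x. c)"
proof (induction k arbitrary: c)
  case (Suc k)
  show ?case
    by (rule Ck_on_SucI[where f' = "\<lambda>x v. 0"]) (use Suc in auto)
qed auto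

lemma Ck_on_bounded_linear: "open S \<Longrightarrow> bounded_linear f \<Longrightarrow> Ck_on k S f"
proof (cases k)
  case (Suc k)
  assume "open S" "bounded_linear f"
  then show ?thesis unfolding Suc
    by (intro Ck_on_SucI[where f' = "\<lambda>x. f"])
      (auto intro: bounded_linear_imp_has_derivative Ck_on_const)
qed (auto intro: linear_continuous_on)

lemma Ck_on_add:
  assumes "open S" "Ck_on k S f" "Ck_on k S g"
  shows "Ck_on k S (\<lambda>x. f x + g x)"
  using assms(2,3)
proof (induction k arbitrary: f g)
  case 0
  then show ?case by (auto intro: continuous_on_add)
next
  case (Suc k)
  show ?case
    by (rule Ck_on_SucI[OF \<open>open S\<close>, where f' = "\<lambda>x v. frechet_derivative f (at x) v
          + frechet_derivative g (at x) v"])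
      (use Suc in \<open>auto intro!: has_derivative_add Ck_on_SucD[where k=k]\<close>)
qed

lemma (in bounded_bilinear) Ck_on:
  assumes "open S" "Ck_on k S f" "Ck_on k S g"
  shows "Ck_on k S (\<lambda>x. prod (f x) (g x))"
  using assms(2,3)
proof (induction k arbitrary: f g)
  case 0
  then show ?case by (auto intro: continuous_on)
next
  case (Suc k)
  have "Ck_on k S f" "Ck_on k S g"
    using Suc.prems Ck_on_lower by blast+
  moreover have "Ck_on k S (\<lambda>x. frechet_derivative f (at x) v)"
      "Ck_on k S (\<lambda>x. frechet_derivative g (at x) v)" for v
    using Suc.prems by auto
  ultimately show ?case
    by (intro Ck_on_SucI[OF \<open>open S\<close>, where f' = "\<lambda>x v. prod (f x) (frechet_derivative g (at x) v)
          + prod (frechet_derivative f (at x) v) (g x)"])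
      (use Suc.prems in \<open>auto intro!: FDERIV Ck_on_add Suc.IH \<open>open S\<close> Ck_on_SucD[where k=k]\<close>)
qed

lemmas Ck_on_mult = bounded_bilinear.Ck_on[OF bounded_bilinear_mult]
lemmas Ck_on_scaleR = bounded_bilinear.Ck_on[OF bounded_bilinear_scaleR]
lemmas Ck_on_inner = bounded_bilinear.Ck_on[OF bounded_bilinear_inner]

lemma Ck_on_diff:
  assumes "open S" "Ck_on k S f" "Ck_on k S g"
  shows "Ck_on k S (\<lambda>x. f x - g x)"
proof -
  have "Ck_on k S (\<lambda>x. f x + (- 1) *\<^sub>R g x)"
    by (intro Ck_on_add Ck_on_scaleR Ck_on_const assms)
  then show ?thesis by simp
qed

lemma Ck_on_sum:
  assumes "open S" "\<And>i. i \<in> I \<Longrightarrow> Ck_on k S (f i)"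
  shows "Ck_on k S (\<lambda>x. \<Sum>i\<in>I. f i x)"
  using assms(2)
proof (induction I rule: infinite_finite_induct)
  case (insert i I)
  then show ?case by (simp add: Ck_on_add \<open>open S\<close>)
qed (simp_all add: Ck_on_const \<open>open S\<close>)

lemma Ck_on_compose:
  fixes f :: "'a::real_normed_vector \<Rightarrow> 'b::euclidean_space"
    and g :: "'b \<Rightarrow> 'c::real_normed_vector"
  assumes "open S" "open T" "f ` S \<subseteq> T" "Ck_on k T g" "Ck_on k S f"
  shows "Ck_on k S (\<lambda>x. g (f x))"
  using assms(4,5)
proof (induction k arbitrary: g)
  case 0
  then show ?case using assms(3) continuous_on_compose2[of T g S f] by simp
next
  case (Suc k)
  let ?g' = "\<lambda>y. frechet_derivative g (at y)" and ?f' = "\<lambda>x. frechet_derivative f (at x)"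
  have der: "((\<lambda>x. g (f x)) has_derivative
      (\<lambda>v. \<Sum>i\<in>Basis. (?f' x v \<bullet> i) *\<^sub>R ?g' (f x) i)) (at x)" if "x \<in> S" for x
  proof -
    have g: "(g has_derivative ?g' (f x)) (at (f x))"
      using Ck_on_SucD[OF Suc.prems(1)] that assms(3) by blast
    then have lin: "linear (?g' (f x))"
      by (rule has_derivative_linear)
    \<comment> \<open>The chain rule puts \<open>x\<close> into the base point and into the
      direction of \<open>?g'\<close>, while the induction hypothesis covers fixed directions only.
      Expanding the direction in \<open>Basis\<close> separates the two.\<close>
    have rep: "?g' (f x) w = (\<Sum>i\<in>Basis. (w \<bullet> i) *\<^sub>R ?g' (f x) i)" for w
      by (subst (1) euclidean_representation[of w, symmetric])
        (simp only: linear_sum[OF lin] linear_scale[OF lin])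
    show ?thesis
      by (rule has_derivative_eq_rhs[OF has_derivative_compose[OF Ck_on_SucD[OF Suc.prems(2) that] g]
            ext[OF rep]])
  qed
  have "Ck_on k S (\<lambda>x. ?g' (f x) i)" for i
    using Suc.IH[of "\<lambda>y. ?g' y i"] Suc.prems Ck_on_lower[OF Suc.prems(2)] by simp
  moreover have "Ck_on k S (\<lambda>x. ?f' x v)" for v
    using Suc.prems by auto
  ultimately show ?case
    by (intro Ck_on_SucI[OF \<open>open S\<close> der] Ck_on_sum Ck_on_scaleR Ck_on_inner Ck_on_const \<open>open S\<close>)
qed

section \<open>A smooth cutoff function\<close>

definition flat :: "nat \<Rightarrow> real \<Rightarrow> real" where
  "flat n t = (if t \<le> 0 then 0 else exp (- inverse t) * inverse t ^ n)"

lemma flat_pos: "t > 0 \<Longrightarrow> flat n t > 0"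
  and flat_nonpos: "t \<le> 0 \<Longrightarrow> flat n t = 0"
  by (auto simp: flat_def)

text \<open>On the right, substituting s = 1/t turns this into the limit of s^n / exp s at
  infinity.\<close>

lemma flat_tendsto_0: "(flat n \<longlongrightarrow> 0) (at 0)"
proof (rule filterlim_split_at)
  have "((\<lambda>t::real. exp (- inverse t) * inverse t ^ n) \<longlongrightarrow> 0) (at_right 0)"
    using filterlim_compose[OF tendsto_power_div_exp_0 filterlim_inverse_at_top_right, of n]
    by (simp add: exp_minus divide_inverse mult.commute)
  moreover have "\<forall>\<^sub>F t in at_right 0. exp (- inverse t) * inverse t ^ n = flat n t"
    by (auto simp: flat_def eventually_at_filter)
  ultimately show "(flat n \<longlongrightarrow> 0) (at_right 0)"
    by (rule Lim_transform_eventually)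
  have "\<forall>\<^sub>F t in at_left 0. 0 = flat n t"
    by (auto simp: flat_def eventually_at_filter)
  then show "(flat n \<longlongrightarrow> 0) (at_left 0)"
    by (rule Lim_transform_eventually[OF tendsto_const])
qed

text \<open>The powers of 1/t are carried along to make the family closed under differentiation up
  to linear combinations: one induction on the order, for all \<open>n\<close> at once, then gives
  smoothness.\<close>

lemma flat_has_real_derivative:
  "(flat n has_real_derivative (flat (n + 2) t - n * flat (n + 1) t)) (at t)"
proof -
  consider "t < 0" | "t = 0" | "t > 0" by linarith
  then show ?thesis
  proof cases
    case 1
    have "((\<lambda>t. 0) has_real_derivative 0) (at t)" by simp
    then have "(flat n has_real_derivative 0) (at t)"
      by (rule has_field_derivative_transform_within_open[where S = "{..<0}"])
        (use 1 in \<open>auto simp: flat_def\<close>)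
    then show ?thesis using 1 by (simp add: flat_nonpos)
  next
    case 2
    \<comment> \<open>The difference quotient at 0 is again a member of the family, so its limit is
      already known.\<close>
    have "\<forall>\<^sub>F s in at 0. flat (n + 1) s = (flat n s - flat n 0) / (s - 0)"
      by (auto simp: flat_def divide_inverse mult_ac)
    then have "((\<lambda>s. (flat n s - flat n 0) / (s - 0)) \<longlongrightarrow> 0) (at 0)"
      by (rule Lim_transform_eventually[OF flat_tendsto_0])
    then have "(flat n has_real_derivative 0) (at 0)"
      by (simp only: has_field_derivative_iff)
    then show ?thesis using 2 by (simp add: flat_nonpos)
  next
    case 3
    have inv: "(inverse has_real_derivative - (inverse t ^ 2)) (at t)"
      using DERIV_inverse[of t UNIV] 3 by (simp add: power2_eq_square)
    \<comment> \<open>\<open>n - Suc 0\<close> comes from the power rule and is truncated for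
      \<open>n = 0\<close>, where the factor \<open>real n\<close> removes the term; hence the case
      split on \<open>n\<close>.\<close>
    have eq: "e * - (- (u ^ 2)) * u ^ n + real n * (- (u ^ 2) * u ^ (n - Suc 0)) * e
        = e * u ^ (n + 2) - n * (e * u ^ (n + 1))" for e u :: real
      by (cases n) (simp_all add: power2_eq_square)
    have "((\<lambda>t. exp (- inverse t) * inverse t ^ n) has_real_derivative
        exp (- inverse t) * inverse t ^ (n + 2) - n * (exp (- inverse t) * inverse t ^ (n + 1))) (at t)"
      using DERIV_mult[OF DERIV_fun_exp[OF DERIV_minus[OF inv]] DERIV_power[OF inv, of n]]
      unfolding eq .
    moreover have "flat m t = exp (- inverse t) * inverse t ^ m" for m
      using 3 by (simp add: flat_def)
    ultimately have "((\<lambda>t. exp (- inverse t) * inverse t ^ n) has_real_derivative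
        (flat (n + 2) t - n * flat (n + 1) t)) (at t)"
      by (simp only:)
    then show ?thesis
      by (rule has_field_derivative_transform_within_open[where S = "{0<..}"])
        (use 3 in \<open>auto simp: flat_def\<close>)
  qed
qed

lemma Ck_on_flat: "Ck_on k UNIV (flat n)"
proof (induction k arbitrary: n)
  case 0
  show ?case
    by (simp add: continuous_on_eq_continuous_at DERIV_isCont[OF flat_has_real_derivative])
next
  case (Suc k)
  show ?case
    by (rule Ck_on_SucI[OF open_UNIV
          flat_has_real_derivative[unfolded has_field_derivative_def]])
      (intro Ck_on_mult Ck_on_diff Ck_on_const open_UNIV Suc.IH)
qed

text \<open>The squared distance is used because it is smooth at \<open>a\<close> as well. For r > 0
  the function is positive exactly inside the ball of radius \<open>r\<close> about
  \<open>a\<close>.\<close>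

lemma Ck_on_bump: "Ck_on k UNIV (\<lambda>x::'e::euclidean_space. flat 0 (r\<^sup>2 - (x - a) \<bullet> (x - a)))"
proof -
  have "Ck_on k UNIV (\<lambda>x. r\<^sup>2 - (x - a) \<bullet> (x - a))"
    by (intro Ck_on_diff Ck_on_const Ck_on_inner Ck_on_bounded_linear bounded_linear_ident open_UNIV)
  then show ?thesis
    by (rule Ck_on_compose[OF open_UNIV open_UNIV subset_UNIV Ck_on_flat])
qed

lemma smooth_on_cong:
  assumes "open S" "\<And>x. x \<in> S \<Longrightarrow> f x = g x" "smooth_on S f"
  shows "smooth_on S g"
  unfolding smooth_on_def
  by (rule allI, rule Ck_on_cong[OF assms(1,2)]) (use assms(3) in \<open>simp_all add: smooth_on_def\<close>)

lemma smooth_on_Un: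
  "open S \<Longrightarrow> open T \<Longrightarrow> smooth_on S f \<Longrightarrow> smooth_on T f \<Longrightarrow> smooth_on (S \<union> T) f"
  by (auto simp: smooth_on_def intro: Ck_on_Un)

lemma smooth_on_const: "open S \<Longrightarrow> smooth_on S (\<lambda>x. c)"
  by (simp add: smooth_on_def Ck_on_const)

lemma smooth_on_add:
  "open S \<Longrightarrow> smooth_on S f \<Longrightarrow> smooth_on S g \<Longrightarrow> smooth_on S (\<lambda>x. f x + g x)"
  by (simp add: smooth_on_def Ck_on_add)

lemma smooth_on_mult:
  fixes f g :: "'e::real_normed_vector \<Rightarrow> real"
  shows "open S \<Longrightarrow> smooth_on S f \<Longrightarrow> smooth_on S g \<Longrightarrow> smooth_on S (\<lambda>x. f x * g x)"
  by (simp add: smooth_on_def Ck_on_mult)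

lemma smooth_on_compose:
  fixes f :: "'e::real_normed_vector \<Rightarrow> 'f::euclidean_space"
  assumes "open S" "open T" "f ` S \<subseteq> T" "smooth_on T g" "smooth_on S f"
  shows "smooth_on S (\<lambda>x. g (f x))"
  unfolding smooth_on_def
proof
  fix k
  show "Ck_on k S (\<lambda>x. g (f x))"
    by (rule Ck_on_compose[OF assms(1-3)]) (use assms(4,5) in \<open>simp_all add: smooth_on_def\<close>)
qed

lemma smooth_on_has_derivative:
  assumes "smooth_on S f" "x \<in> S"
  shows "(f has_derivative frechet_derivative f (at x)) (at x)"
  by (rule Ck_on_SucD[of 0 S]) (use assms in \<open>simp_all only: smooth_on_def\<close>)

lemma smooth_on_frechet_derivative:
  assumes "smooth_on S f"
  shows "smooth_on S (\<lambda>x. frechet_derivative f (at x) v)"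
  unfolding smooth_on_def
proof
  fix k
  have "Ck_on (Suc k) S f"
    using assms by (simp only: smooth_on_def)
  then show "Ck_on k S (\<lambda>x. frechet_derivative f (at x) v)"
    by simp
qed

section \<open>Tangent vectors and vector fields\<close>

lemma scale_apply: "scale c v f = c * v f"
  by (simp add: scale_def)

lemma tvec_scale_add_right: "scale c (v + w) = scale c v + scale c w"
  and tvec_scale_add_left: "scale (c + d) v = scale c v + scale d v"
  and tvec_scale_scale: "scale c (scale d v) = scale (c * d) v"
  and tvec_scale_minus_one: "scale (- 1) v = - v"
  and tvec_scale_zero_left: "scale 0 v = 0"
  and tvec_scale_zero_right: "scale c 0 = 0"
  by (simp_all add: scale_def fun_eq_iff distrib_left distrib_right mult.assoc)

lemma tvec_scale_sum_right: "scale c (\<Sum>i\<in>I. v i) = (\<Sum>i\<in>I. scale c (v i))"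
  by (induction I rule: infinite_finite_induct)
    (simp_all only: sum.infinite sum.empty sum.insert tvec_scale_add_right tvec_scale_zero_right
      not_False_eq_True)

context smooth_manifold
begin

lemma open_chart_domain: "(U, \<phi>) \<in> \<A> \<Longrightarrow> open U"
  and inj_on_chart: "(U, \<phi>) \<in> \<A> \<Longrightarrow> inj_on \<phi> U"
  and homeomorphism_chart: "(U, \<phi>) \<in> \<A> \<Longrightarrow> homeomorphism U (\<phi> ` U) \<phi> (inv_into U \<phi>)"
  using chart[of U \<phi>] by (auto simp: homeomorphism_def intro: inj_on_inverseI)

lemma inv_into_chart: "(U, \<phi>) \<in> \<A> \<Longrightarrow> q \<in> U \<Longrightarrow> inv_into U \<phi> (\<phi> q) = q"
  using inj_on_chart by simp

lemma open_chart_image: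
  assumes "(U, \<phi>) \<in> \<A>" "open W"
  shows "open (\<phi> ` (U \<inter> W))"
proof -
  have "openin (top_of_set (\<phi> ` U)) (\<phi> ` (U \<inter> W))"
    using homeomorphism_imp_open_map[OF homeomorphism_chart[OF assms(1)]] assms(2)
      openin_open_Int by blast
  moreover have "open (\<phi> ` U)"
    using chart assms(1) by blast
  ultimately show ?thesis
    using openin_open_eq by blast
qed

lemma open_chart_range: "(U, \<phi>) \<in> \<A> \<Longrightarrow> open (\<phi> ` U)"
  using open_chart_image[of U \<phi> UNIV] by simp

lemma ex_chart: obtains U \<phi> where "(U, \<phi>) \<in> \<A>" "p \<in> U"
proof -
  have "p \<in> (\<Union>(U, \<phi>)\<in>\<A>. U)"
    using covering by simp
  then show thesis
    using that by blast
qed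

lemma smooth_functionsD:
  "f \<in> smooth_functions \<A> \<Longrightarrow> (U, \<phi>) \<in> \<A> \<Longrightarrow> smooth_on (\<phi> ` U) (f \<circ> inv_into U \<phi>)"
  by (auto simp: smooth_functions_def)

lemma smooth_functions_const: "(\<lambda>p. c) \<in> smooth_functions \<A>"
  by (auto simp: smooth_functions_def o_def smooth_on_const open_chart_range)

lemma smooth_functions_add:
  "f \<in> smooth_functions \<A> \<Longrightarrow> h \<in> smooth_functions \<A> \<Longrightarrow> (\<lambda>p. f p + h p) \<in> smooth_functions \<A>"
  by (auto simp: smooth_functions_def o_def intro!: smooth_on_add open_chart_range)

lemma smooth_functions_mult:
  "f \<in> smooth_functions \<A> \<Longrightarrow> h \<in> smooth_functions \<A> \<Longrightarrow> (\<lambda>p. f p * h p) \<in> smooth_functions \<A>"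
  by (auto simp: smooth_functions_def o_def intro!: smooth_on_mult open_chart_range)

lemma smooth_functions_minus:
  "f \<in> smooth_functions \<A> \<Longrightarrow> (\<lambda>p. - f p) \<in> smooth_functions \<A>"
  using smooth_functions_mult[OF smooth_functions_const[of "-1"], of f] by simp

lemma smooth_functions_diff:
  "f \<in> smooth_functions \<A> \<Longrightarrow> h \<in> smooth_functions \<A> \<Longrightarrow> (\<lambda>p. f p - h p) \<in> smooth_functions \<A>"
  using smooth_functions_add[OF _ smooth_functions_minus, of f h] by simp

section \<open>Tangent vectors in a chart\<close>

lemma directional_derivative_has_derivative:
  assumes "f \<in> smooth_functions \<A>" "(U, \<phi>) \<in> \<A>" "p \<in> U"
  shows "((f \<circ> inv_into U \<phi>) has_derivative (\<lambda>u. directional_derivative \<A> (U, \<phi>) p u f)) (at (\<phi> p))"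
  using smooth_on_has_derivative[OF smooth_functionsD[OF assms(1,2)], of "\<phi> p"] assms
  by (simp add: directional_derivative_def)

lemma directional_derivativeI:
  assumes "f \<in> smooth_functions \<A>" "((f \<circ> inv_into U \<phi>) has_derivative D) (at (\<phi> p))"
  shows "directional_derivative \<A> (U, \<phi>) p u f = D u"
  using frechet_derivative_at[OF assms(2)] assms(1) by (simp add: directional_derivative_def)

lemma directional_derivative_nonsmooth:
  "f \<notin> smooth_functions \<A> \<Longrightarrow> directional_derivative \<A> (U, \<phi>) p u f = 0"
  by (simp add: directional_derivative_def)

lemma directional_derivative_add:
  assumes "(U, \<phi>) \<in> \<A>" "p \<in> U"
  shows "directional_derivative \<A> (U, \<phi>) p (u + v) =
    directional_derivative \<A> (U, \<phi>) p u + directional_derivative \<A> (U, \<phi>) p v"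
proof
  fix f
  show "directional_derivative \<A> (U, \<phi>) p (u + v) f =
    (directional_derivative \<A> (U, \<phi>) p u + directional_derivative \<A> (U, \<phi>) p v) f"
    using has_derivative_linear[OF directional_derivative_has_derivative[OF _ assms, of f]]
      directional_derivative_nonsmooth[of f]
    by (cases "f \<in> smooth_functions \<A>") (auto dest: linear_add)
qed

lemma directional_derivative_scale:
  assumes "(U, \<phi>) \<in> \<A>" "p \<in> U"
  shows "directional_derivative \<A> (U, \<phi>) p (c *\<^sub>R u) = scale c (directional_derivative \<A> (U, \<phi>) p u)"
proof
  fix f
  show "directional_derivative \<A> (U, \<phi>) p (c *\<^sub>R u) f =
    scale c (directional_derivative \<A> (U, \<phi>) p u) f"
    using has_derivative_linear[OF directional_derivative_has_derivative[OF _ assms, of f]]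
      directional_derivative_nonsmooth[of f]
    by (cases "f \<in> smooth_functions \<A>") (auto dest: linear_scale simp: scale_def)
qed

text \<open>The chain rule for the transition map. All charts around a point therefore yield the
  same tangent vectors, which makes the union over charts in \<open>tangent_space\<close> a vector
  space.\<close>

lemma directional_derivative_change_chart:
  assumes U: "(U, \<phi>) \<in> \<A>" "p \<in> U" and V: "(V, \<psi>) \<in> \<A>" "p \<in> V"
  shows "directional_derivative \<A> (V, \<psi>) p u =
    directional_derivative \<A> (U, \<phi>) p (frechet_derivative (\<phi> \<circ> inv_into V \<psi>) (at (\<psi> p)) u)"
proof
  fix f
  let ?\<tau> = "\<phi> \<circ> inv_into V \<psi>" and ?S = "\<psi> ` (V \<inter> U)"
  show "directional_derivative \<A> (V, \<psi>) p u f =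
    directional_derivative \<A> (U, \<phi>) p (frechet_derivative ?\<tau> (at (\<psi> p)) u) f"
  proof (cases "f \<in> smooth_functions \<A>")
    case True
    have \<tau>: "(?\<tau> has_derivative frechet_derivative ?\<tau> (at (\<psi> p))) (at (\<psi> p))"
      by (rule smooth_on_has_derivative[OF transition[OF V(1) U(1)]]) (use U V in auto)
    have "((f \<circ> inv_into U \<phi>) has_derivative (\<lambda>u. directional_derivative \<A> (U, \<phi>) p u f))
        (at (?\<tau> (\<psi> p)))"
      using directional_derivative_has_derivative[OF True U] inv_into_chart[OF V] by simp
    then have "((\<lambda>x. (f \<circ> inv_into U \<phi>) (?\<tau> x)) has_derivative
        (\<lambda>u. directional_derivative \<A> (U, \<phi>) p (frechet_derivative ?\<tau> (at (\<psi> p)) u) f))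
        (at (\<psi> p))"
      by (rule has_derivative_compose[OF \<tau>])
    then have "((f \<circ> inv_into V \<psi>) has_derivative
        (\<lambda>u. directional_derivative \<A> (U, \<phi>) p (frechet_derivative ?\<tau> (at (\<psi> p)) u) f))
        (at (\<psi> p))"
      by (rule has_derivative_transform_within_open
          [OF _ open_chart_image[OF V(1) open_chart_domain[OF U(1)]]])
        (use U V in \<open>auto simp: inv_into_chart\<close>)
    then show ?thesis
      by (rule directional_derivativeI[OF True])
  qed (simp add: directional_derivative_nonsmooth)
qed

lemma tangent_space_eq_range:
  assumes "(U, \<phi>) \<in> \<A>" "p \<in> U"
  shows "tangent_space \<A> p = range (directional_derivative \<A> (U, \<phi>) p)"
proof
  show "tangent_space \<A> p \<subseteq> range (directional_derivative \<A> (U, \<phi>) p)"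
    using directional_derivative_change_chart[OF assms] unfolding tangent_space_def by fastforce
  show "range (directional_derivative \<A> (U, \<phi>) p) \<subseteq> tangent_space \<A> p"
    using assms unfolding tangent_space_def by fastforce
qed

lemma tangent_space_add:
  assumes "v \<in> tangent_space \<A> p" "w \<in> tangent_space \<A> p"
  shows "v + w \<in> tangent_space \<A> p"
proof -
  obtain U \<phi> where "(U, \<phi>) \<in> \<A>" "p \<in> U" by (rule ex_chart)
  note chart = this
  obtain a b where "v = directional_derivative \<A> (U, \<phi>) p a" "w = directional_derivative \<A> (U, \<phi>) p b"
    using assms unfolding tangent_space_eq_range[OF chart] by blast
  then have "v + w = directional_derivative \<A> (U, \<phi>) p (a + b)"
    by (simp only: directional_derivative_add[OF chart])
  then show ?thesis
    unfolding tangent_space_eq_range[OF chart] by (rule range_eqI)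
qed

lemma tangent_space_scale:
  assumes "v \<in> tangent_space \<A> p"
  shows "scale c v \<in> tangent_space \<A> p"
proof -
  obtain U \<phi> where "(U, \<phi>) \<in> \<A>" "p \<in> U" by (rule ex_chart)
  note chart = this
  obtain a where "v = directional_derivative \<A> (U, \<phi>) p a"
    using assms unfolding tangent_space_eq_range[OF chart] by blast
  then have "scale c v = directional_derivative \<A> (U, \<phi>) p (c *\<^sub>R a)"
    by (simp only: directional_derivative_scale[OF chart])
  then show ?thesis
    unfolding tangent_space_eq_range[OF chart] by (rule range_eqI)
qed

text \<open>The support lies in the compact set \<open>K\<close>, which is closed because the
  manifold is Hausdorff. In any other chart, \<open>U\<close> and the complement of \<open>K\<close>
  give an open cover: on the first the function is \<open>F\<close> after a transition map, on the
  second it is 0.\<close>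

lemma smooth_functions_extend_zero:
  assumes U: "(U, \<phi>) \<in> \<A>" and F: "smooth_on (\<phi> ` U) F" and sub: "cball a r \<subseteq> \<phi> ` U"
    and zero: "\<And>x. x \<in> \<phi> ` U \<Longrightarrow> x \<notin> cball a r \<Longrightarrow> F x = 0"
  shows "(\<lambda>q. if q \<in> U then F (\<phi> q) else 0) \<in> smooth_functions \<A>"
proof -
  let ?f = "\<lambda>q. if q \<in> U then F (\<phi> q) else 0"
  define K where "K = inv_into U \<phi> ` cball a r"
  have "continuous_on (cball a r) (inv_into U \<phi>)"
    using homeomorphism_chart[OF U] sub by (auto simp: homeomorphism_def intro: continuous_on_subset)
  then have "closed K"
    unfolding K_def by (intro compact_imp_closed compact_continuous_image compact_cball)
  then have open_K: "open (- K)"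
    by (simp add: open_Compl)
  have zero': "?f q = 0" if "q \<notin> K" for q
  proof (cases "q \<in> U")
    case True
    have "\<phi> q \<notin> cball a r"
      using that inv_into_chart[OF U True] unfolding K_def by (metis imageI)
    then show ?thesis using zero True by simp
  qed simp
  have "smooth_on (\<psi> ` V) (?f \<circ> inv_into V \<psi>)" if V: "(V, \<psi>) \<in> \<A>" for V \<psi>
  proof -
    have K_sub: "K \<subseteq> U"
      using sub inv_into_into[of _ \<phi> U] unfolding K_def by blast
    have "smooth_on (\<psi> ` (V \<inter> U)) (\<lambda>x. F ((\<phi> \<circ> inv_into V \<psi>) x))"
    proof (rule smooth_on_compose[OF _ _ _ F transition[OF V U]])
      show "(\<phi> \<circ> inv_into V \<psi>) ` \<psi> ` (V \<inter> U) \<subseteq> \<phi> ` U"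
        by (auto simp: inv_into_chart[OF V])
    qed (use open_chart_image[OF V open_chart_domain[OF U]] open_chart_range[OF U] in simp_all)
    then have 1: "smooth_on (\<psi> ` (V \<inter> U)) (?f \<circ> inv_into V \<psi>)"
      by (rule smooth_on_cong[rotated 2])
        (auto simp: open_chart_image open_chart_domain[OF U] V inv_into_chart[OF V])
    have 2: "smooth_on (\<psi> ` (V \<inter> - K)) (?f \<circ> inv_into V \<psi>)"
    proof (rule smooth_on_cong[OF _ _ smooth_on_const])
      show "0 = (?f \<circ> inv_into V \<psi>) x" if "x \<in> \<psi> ` (V \<inter> - K)" for x
        using that zero'[of "inv_into V \<psi> x"] inv_into_chart[OF V] by (auto simp del: if_split)
    qed (simp_all add: open_chart_image open_K V)
    have "\<psi> ` V = \<psi> ` (V \<inter> U) \<union> \<psi> ` (V \<inter> - K)"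
      using K_sub by blast
    then show ?thesis
      using smooth_on_Un[OF _ _ 1 2] by (simp add: open_chart_image open_chart_domain[OF U] open_K V)
  qed
  then show ?thesis
    by (auto simp: smooth_functions_def)
qed

lemma tangent_space_zero: "0 \<in> tangent_space \<A> p"
proof -
  obtain U \<phi> where "(U, \<phi>) \<in> \<A>" "p \<in> U" by (rule ex_chart)
  then have "directional_derivative \<A> (U, \<phi>) p 0 \<in> tangent_space \<A> p"
    using tangent_space_eq_range by blast
  then show ?thesis
    using tangent_space_scale[of _ p 0] by (simp add: tvec_scale_zero_left)
qed

lemma tangent_space_minus: "v \<in> tangent_space \<A> p \<Longrightarrow> - v \<in> tangent_space \<A> p"
  using tangent_space_scale[of v p "- 1"] by (simp add: tvec_scale_minus_one)

lemma tangent_space_diff: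
  "v \<in> tangent_space \<A> p \<Longrightarrow> w \<in> tangent_space \<A> p \<Longrightarrow> v - w \<in> tangent_space \<A> p"
  using tangent_space_add[of v p "- w"] tangent_space_minus[of w p] by simp

lemma tangent_in_chart:
  assumes "v \<in> tangent_space \<A> p" "(U, \<phi>) \<in> \<A>" "p \<in> U"
  obtains u where "v = directional_derivative \<A> (U, \<phi>) p u"
  using assms(1) unfolding tangent_space_eq_range[OF assms(2,3)] by auto

lemma tangent_has_derivative:
  assumes "v \<in> tangent_space \<A> p"
  obtains U \<phi> u where "(U, \<phi>) \<in> \<A>" "p \<in> U" "v = directional_derivative \<A> (U, \<phi>) p u"
    "\<And>f. f \<in> smooth_functions \<A> \<Longrightarrow> ((f \<circ> inv_into U \<phi>) has_derivative
      (\<lambda>u. directional_derivative \<A> (U, \<phi>) p u f)) (at (\<phi> p))"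
proof -
  obtain U \<phi> where U: "(U, \<phi>) \<in> \<A>" "p \<in> U" by (rule ex_chart)
  then obtain u where "v = directional_derivative \<A> (U, \<phi>) p u"
    by (rule tangent_in_chart[OF assms])
  with U show thesis
    using that directional_derivative_has_derivative[OF _ U] by blast
qed

section \<open>Tangent vectors as derivations, and vector fields\<close>

lemma tangent_const:
  assumes "v \<in> tangent_space \<A> p"
  shows "v (\<lambda>q. c) = 0"
proof -
  obtain U \<phi> u where U: "(U, \<phi>) \<in> \<A>" "p \<in> U" and v: "v = directional_derivative \<A> (U, \<phi>) p u"
    using tangent_has_derivative[OF assms] by metis
  have "(((\<lambda>q. c) \<circ> inv_into U \<phi>) has_derivative (\<lambda>u. 0)) (at (\<phi> p))"
    by (simp add: o_def)
  then show ?thesis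
    unfolding v by (rule directional_derivativeI[OF smooth_functions_const])
qed

lemma tangent_plus:
  assumes v: "v \<in> tangent_space \<A> p" and f: "f \<in> smooth_functions \<A>" and h: "h \<in> smooth_functions \<A>"
  shows "v (\<lambda>q. f q + h q) = v f + v h"
proof -
  obtain U \<phi> u where v: "v = directional_derivative \<A> (U, \<phi>) p u" and
    D: "\<And>f. f \<in> smooth_functions \<A> \<Longrightarrow> ((f \<circ> inv_into U \<phi>) has_derivative
      (\<lambda>u. directional_derivative \<A> (U, \<phi>) p u f)) (at (\<phi> p))"
    using tangent_has_derivative[OF v] by metis
  have "(((\<lambda>q. f q + h q) \<circ> inv_into U \<phi>) has_derivative
     (\<lambda>u. directional_derivative \<A> (U, \<phi>) p u f + directional_derivative \<A> (U, \<phi>) p u h)) (at (\<phi> p))"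
    using has_derivative_add[OF D[OF f] D[OF h]] by (simp add: o_def)
  then show ?thesis
    unfolding v by (rule directional_derivativeI[OF smooth_functions_add[OF f h]])
qed

lemma tangent_mult:
  assumes v: "v \<in> tangent_space \<A> p" and f: "f \<in> smooth_functions \<A>" and h: "h \<in> smooth_functions \<A>"
  shows "v (\<lambda>q. f q * h q) = f p * v h + v f * h p"
proof -
  obtain U \<phi> u where U: "(U, \<phi>) \<in> \<A>" "p \<in> U" and v: "v = directional_derivative \<A> (U, \<phi>) p u" and
    D: "\<And>f. f \<in> smooth_functions \<A> \<Longrightarrow> ((f \<circ> inv_into U \<phi>) has_derivative
      (\<lambda>u. directional_derivative \<A> (U, \<phi>) p u f)) (at (\<phi> p))"
    using tangent_has_derivative[OF v] by metis
  have "(((\<lambda>q. f q * h q) \<circ> inv_into U \<phi>) has_derivative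
     (\<lambda>u. f p * directional_derivative \<A> (U, \<phi>) p u h + directional_derivative \<A> (U, \<phi>) p u f * h p))
     (at (\<phi> p))"
    using has_derivative_mult[OF D[OF f] D[OF h]] by (simp add: o_def inv_into_chart[OF U])
  then show ?thesis
    unfolding v by (rule directional_derivativeI[OF smooth_functions_mult[OF f h]])
qed

lemma tangent_minus:
  "v \<in> tangent_space \<A> p \<Longrightarrow> f \<in> smooth_functions \<A> \<Longrightarrow> v (\<lambda>q. - f q) = - v f"
  using tangent_mult[OF _ smooth_functions_const[of "- 1"], of v p f] tangent_const[of v p "- 1"] by simp

lemma tangent_diff:
  "v \<in> tangent_space \<A> p \<Longrightarrow> f \<in> smooth_functions \<A> \<Longrightarrow> h \<in> smooth_functions \<A>
    \<Longrightarrow> v (\<lambda>q. f q - h q) = v f - v h"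
  using tangent_plus[OF _ _ smooth_functions_minus, of v p f h] tangent_minus[of v p h] by simp

lemma vector_fields_tangent: "X \<in> vector_fields \<A> \<Longrightarrow> X p \<in> tangent_space \<A> p"
  and vector_fields_smooth:
    "X \<in> vector_fields \<A> \<Longrightarrow> f \<in> smooth_functions \<A> \<Longrightarrow> (\<lambda>p. X p f) \<in> smooth_functions \<A>"
  by (auto simp: vector_fields_def)

lemma vector_fields_add: "X \<in> vector_fields \<A> \<Longrightarrow> Y \<in> vector_fields \<A> \<Longrightarrow> X + Y \<in> vector_fields \<A>"
  by (auto simp: vector_fields_def intro: tangent_space_add smooth_functions_add)

lemma vector_fields_scale:
  "f \<in> smooth_functions \<A> \<Longrightarrow> X \<in> vector_fields \<A> \<Longrightarrow> (\<lambda>q. scale (f q) (X q)) \<in> vector_fields \<A>"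
  by (auto simp: vector_fields_def scale_apply intro: tangent_space_scale smooth_functions_mult)

lemma vector_fields_zero: "0 \<in> vector_fields \<A>"
  by (auto simp: vector_fields_def tangent_space_zero smooth_functions_const)

lemma vector_fields_diff: "X \<in> vector_fields \<A> \<Longrightarrow> Y \<in> vector_fields \<A> \<Longrightarrow> X - Y \<in> vector_fields \<A>"
  by (auto simp: vector_fields_def intro: tangent_space_diff smooth_functions_diff)

lemma vector_fields_sum:
  "(\<And>i. i \<in> I \<Longrightarrow> X i \<in> vector_fields \<A>) \<Longrightarrow> (\<Sum>i\<in>I. X i) \<in> vector_fields \<A>"
  by (induction I rule: infinite_finite_induct) (simp_all add: vector_fields_zero vector_fields_add)

section \<open>Global frames, extensions and tensoriality\<close>

lemma directional_derivative_basis: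
  assumes "(U, \<phi>) \<in> \<A>" "q \<in> U"
  shows "directional_derivative \<A> (U, \<phi>) q u =
    (\<Sum>i\<in>Basis. scale (u \<bullet> i) (directional_derivative \<A> (U, \<phi>) q i))"
proof -
  have zero: "directional_derivative \<A> (U, \<phi>) q 0 = 0"
    using directional_derivative_scale[OF assms, of 0 0] by (simp add: tvec_scale_zero_left)
  have "directional_derivative \<A> (U, \<phi>) q (\<Sum>i\<in>I. (u \<bullet> i) *\<^sub>R i) =
      (\<Sum>i\<in>I. scale (u \<bullet> i) (directional_derivative \<A> (U, \<phi>) q i))" for I
    by (induction I rule: infinite_finite_induct)
      (simp_all add: zero directional_derivative_add[OF assms] directional_derivative_scale[OF assms])
  from this[of Basis] show ?thesis
    by (simp add: euclidean_representation)
qed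


text \<open>The frame is global but degenerates away from \<open>p\<close>, so only multiples \<open>\<beta> X\<close> are combinations of it.\<close>

lemma local_frame:
  obtains \<beta> E where "\<beta> \<in> smooth_functions \<A>" "\<beta> p \<noteq> 0" "\<forall>i::'e. E i \<in> vector_fields \<A>"
    "\<forall>v\<in>tangent_space \<A> p. \<exists>u. v = (\<Sum>i\<in>Basis. scale (u i) (E i p))"
    "\<forall>X\<in>vector_fields \<A>. \<exists>c. (\<forall>i. c i \<in> smooth_functions \<A> \<and> (X p = 0 \<longrightarrow> c i p = 0)) \<and>
      (\<forall>q. scale (\<beta> q) (X q) = (\<Sum>i\<in>Basis. scale (c i q) (E i q)))"
proof -
  obtain U \<phi> where U: "(U, \<phi>) \<in> \<A>" "p \<in> U" by (rule ex_chart)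
  have \<phi>U: "open (\<phi> ` U)" and "\<phi> p \<in> \<phi> ` U"
    using open_chart_range U by auto
  then obtain r where r: "r > 0" "cball (\<phi> p) r \<subseteq> \<phi> ` U"
    by (meson open_contains_cball)
  define B :: "'e \<Rightarrow> real" where "B x = flat 0 (r\<^sup>2 - (x - \<phi> p) \<bullet> (x - \<phi> p))" for x
  have B: "smooth_on (\<phi> ` U) B"
    unfolding smooth_on_def B_def using Ck_on_bump Ck_on_subset by blast
  have B_zero: "B x = 0" if "x \<notin> cball (\<phi> p) r" for x
  proof -
    have "r\<^sup>2 \<le> (norm (x - \<phi> p))\<^sup>2"
      using that r(1) by (intro power_mono) (auto simp: dist_norm norm_minus_commute)
    then show ?thesis
      by (simp add: B_def flat_nonpos power2_norm_eq_inner)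
  qed
  define b where "b = (\<lambda>q. if q \<in> U then B (\<phi> q) else 0)"
  define x where "x = (\<lambda>i q. if q \<in> U then B (\<phi> q) * (\<phi> q \<bullet> i) else 0)"
  define dd where "dd = (\<lambda>i q. directional_derivative \<A> (U, \<phi>) q i)"
  define E where "E = (\<lambda>i q. if q \<in> U then scale (b q) (dd i q) else 0)"
  have b: "b \<in> smooth_functions \<A>"
    unfolding b_def by (rule smooth_functions_extend_zero[OF U(1) B r(2)]) (rule B_zero)
  have b_p: "b p \<noteq> 0"
    using flat_pos[of "r\<^sup>2" 0] r(1) U(2) by (simp add: b_def B_def)
  have x: "x i \<in> smooth_functions \<A>" for i
  proof -
    have "smooth_on (\<phi> ` U) (\<lambda>x. x \<bullet> i)"
      by (simp add: smooth_on_def Ck_on_bounded_linear[OF \<phi>U bounded_linear_inner_left])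
    then show ?thesis
      unfolding x_def
      by (intro smooth_functions_extend_zero[OF U(1) smooth_on_mult[OF \<phi>U B] r(2)]) (simp_all add: B_zero)
  qed
  have E: "E i \<in> vector_fields \<A>" for i
  proof -
    have "E i q \<in> tangent_space \<A> q" for q
    proof (cases "q \<in> U")
      case True
      then have "dd i q \<in> tangent_space \<A> q"
        unfolding dd_def tangent_space_eq_range[OF U(1) True] by simp
      then show ?thesis
        by (simp add: E_def True tangent_space_scale)
    qed (simp add: E_def tangent_space_zero)
    moreover have "(\<lambda>q. E i q f) \<in> smooth_functions \<A>" if f: "f \<in> smooth_functions \<A>" for f
    proof -
      have "(\<lambda>q. if q \<in> U then B (\<phi> q) * frechet_derivative (f \<circ> inv_into U \<phi>) (at (\<phi> q)) i else 0)
          \<in> smooth_functions \<A>"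
        by (rule smooth_functions_extend_zero[OF U(1) smooth_on_mult[OF \<phi>U B
                smooth_on_frechet_derivative[OF smooth_functionsD[OF f U(1)]]] r(2)])
          (simp add: B_zero)
      then show ?thesis
        using f by (simp add: E_def dd_def b_def directional_derivative_def scale_apply
            if_distrib[of "\<lambda>v. v f"] cong: if_cong)
    qed
    ultimately show ?thesis
      by (simp add: vector_fields_def)
  qed
  have span: "\<exists>u. v = (\<Sum>i\<in>Basis. scale (u i) (E i p))" if v: "v \<in> tangent_space \<A> p" for v
  proof -
    obtain u where u: "v = directional_derivative \<A> (U, \<phi>) p u"
      by (rule tangent_in_chart[OF v U])
    have "v = (\<Sum>i\<in>Basis. scale (u \<bullet> i) (dd i p))"
      using directional_derivative_basis[OF U, of u] by (simp only: dd_def u)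
    moreover have "scale (u \<bullet> i) (dd i p) = scale ((u \<bullet> i) / b p) (E i p)" for i
      using b_p U(2) by (simp add: E_def tvec_scale_scale)
    ultimately have "v = (\<Sum>i\<in>Basis. scale ((u \<bullet> i) / b p) (E i p))"
      by (simp only:)
    then show ?thesis by (rule exI[of _ "\<lambda>i. (u \<bullet> i) / b p"])
  qed
  \<comment> \<open>The coordinates \<open>u \<bullet> i\<close> of a vector, recovered up to \<open>b\<^sup>2\<close> from the globally smooth functions \<open>x i\<close>
    and \<open>b\<close> alone; no second cutoff function is needed.\<close>
  have x_coord: "b q * v (x i) - x i q * v b = (b q)\<^sup>2 * (u \<bullet> i)"
    if q: "q \<in> U" and v: "v = directional_derivative \<A> (U, \<phi>) q u" for q u i v
  proof -
    have "((b \<circ> inv_into U \<phi>) has_derivative (\<lambda>u. directional_derivative \<A> (U, \<phi>) q u b)) (at (\<phi> q))"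
      by (rule directional_derivative_has_derivative[OF b U(1) q])
    then have "((\<lambda>z. (b \<circ> inv_into U \<phi>) z * (z \<bullet> i)) has_derivative
        (\<lambda>u. (b \<circ> inv_into U \<phi>) (\<phi> q) * (u \<bullet> i) + directional_derivative \<A> (U, \<phi>) q u b * (\<phi> q \<bullet> i)))
        (at (\<phi> q))"
      by (rule has_derivative_mult) (intro derivative_intros)
    then have "((x i \<circ> inv_into U \<phi>) has_derivative
        (\<lambda>u. b q * (u \<bullet> i) + directional_derivative \<A> (U, \<phi>) q u b * (\<phi> q \<bullet> i))) (at (\<phi> q))"
      unfolding o_apply inv_into_chart[OF U(1) q]
      by (rule has_derivative_transform_within_open[OF _ \<phi>U])
        (use q in \<open>auto simp: x_def b_def inv_into_chart[OF U(1)]\<close>)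
    then have "v (x i) = b q * (u \<bullet> i) + v b * (\<phi> q \<bullet> i)"
      unfolding v by (rule directional_derivativeI[OF x])
    then show ?thesis
      using q by (simp add: x_def b_def power2_eq_square algebra_simps)
  qed
  \<comment> \<open>Two powers of \<open>b\<close> come from \<open>x_coord\<close> and the third
    from \<open>E i\<close>, which is \<open>b\<close> times a coordinate field. The coefficients
    are linear in the value of X, so they vanish at \<open>p\<close> together with it.\<close>
  have frame: "\<exists>c. (\<forall>i. c i \<in> smooth_functions \<A> \<and> (X p = 0 \<longrightarrow> c i p = 0)) \<and>
      (\<forall>q. scale (b q ^ 3) (X q) = (\<Sum>i\<in>Basis. scale (c i q) (E i q)))"
    if X: "X \<in> vector_fields \<A>" for X
  proof (intro exI conjI allI impI)
    let ?c = "\<lambda>i q. b q * X q (x i) - x i q * X q b"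
    show "?c i \<in> smooth_functions \<A>" for i
      by (rule smooth_functions_diff[OF smooth_functions_mult[OF b vector_fields_smooth[OF X x]]
            smooth_functions_mult[OF x vector_fields_smooth[OF X b]]])
    show "?c i p = 0" if "X p = 0" for i
      using that by simp
    show "scale (b q ^ 3) (X q) = (\<Sum>i\<in>Basis. scale (?c i q) (E i q))" for q
    proof (cases "q \<in> U")
      case True
      obtain u where u: "X q = directional_derivative \<A> (U, \<phi>) q u"
        by (rule tangent_in_chart[OF vector_fields_tangent[OF X] U(1) True])
      have "?c i q = (b q)\<^sup>2 * (u \<bullet> i)" for i
        by (rule x_coord[OF True u])
      moreover have "E i q = scale (b q) (dd i q)" for i
        using True by (simp add: E_def)
      moreover have "X q = (\<Sum>i\<in>Basis. scale (u \<bullet> i) (dd i q))"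
        unfolding u dd_def by (rule directional_derivative_basis[OF U(1) True])
      ultimately show ?thesis
        by (simp only: tvec_scale_sum_right tvec_scale_scale)
          (simp add: power2_eq_square power3_eq_cube mult_ac)
    next
      case False
      then have "E i q = 0" "b q ^ 3 = 0" for i
        by (simp_all add: E_def b_def)
      then show ?thesis
        by (simp only: tvec_scale_zero_left tvec_scale_zero_right sum.neutral_const)
    qed
  qed
  have "(\<lambda>q. b q ^ 3) \<in> smooth_functions \<A>"
    using smooth_functions_mult[OF smooth_functions_mult[OF b b] b] by (simp add: power3_eq_cube)
  then show thesis
    using that[of "\<lambda>q. b q ^ 3" E] b_p E span frame by simp
qed

text \<open>Justifies the choice in \<open>extend\<close>: a combination of the global frame with
  constant coefficients takes any prescribed value at \<open>p\<close>.\<close>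

lemma extend_vector_field:
  assumes "v \<in> tangent_space \<A> p"
  shows "extend \<A> p v \<in> vector_fields \<A>" "extend \<A> p v p = v"
proof -
  obtain \<beta> E where "\<beta> \<in> smooth_functions \<A>" "\<beta> p \<noteq> 0" and E: "\<forall>i::'e. E i \<in> vector_fields \<A>" and
    span: "\<forall>v\<in>tangent_space \<A> p. \<exists>u. v = (\<Sum>i\<in>Basis. scale (u i) (E i p))"
    and "\<forall>X\<in>vector_fields \<A>. \<exists>c. (\<forall>i. c i \<in> smooth_functions \<A> \<and> (X p = 0 \<longrightarrow> c i p = 0)) \<and>
      (\<forall>q. scale (\<beta> q) (X q) = (\<Sum>i\<in>Basis. scale (c i q) (E i q)))"
    by (rule local_frame[of p])
  obtain u where u: "v = (\<Sum>i\<in>Basis. scale (u i) (E i p))"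
    using span assms by blast
  have "(\<Sum>i\<in>Basis. (\<lambda>q. scale (u i) (E i q))) \<in> vector_fields \<A>"
    by (intro vector_fields_sum vector_fields_scale[OF smooth_functions_const] E[rule_format])
  moreover have "(\<Sum>i\<in>I. (\<lambda>q. scale (u i) (E i q))) p = (\<Sum>i\<in>I. scale (u i) (E i p))" for I
    by (induction I rule: infinite_finite_induct) simp_all
  ultimately have "(\<Sum>i\<in>Basis. (\<lambda>q. scale (u i) (E i q))) \<in> vector_fields \<A> \<and>
      (\<Sum>i\<in>Basis. (\<lambda>q. scale (u i) (E i q))) p = v"
    by (simp only: u)
  then have "\<exists>X. X \<in> vector_fields \<A> \<and> X p = v"
    by (rule exI[of _ "\<Sum>i\<in>Basis. (\<lambda>q. scale (u i) (E i q))"])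
  then have "extend \<A> p v \<in> vector_fields \<A> \<and> extend \<A> p v p = v"
    unfolding extend_def by (rule someI_ex)
  then show "extend \<A> p v \<in> vector_fields \<A>" "extend \<A> p v p = v"
    by auto
qed

text \<open>By \<open>local_frame\<close>, \<beta>(X - Y) is a combination of the \<open>E i\<close>
  with coefficients vanishing at \<open>p\<close>. Linearity over smooth functions then gives
  \<beta>(p) F(X - Y) = 0, where \<beta>(p) is nonzero.\<close>

lemma tensorial:
  fixes F :: "'a vfield \<Rightarrow> 'a tvec"
  assumes add: "\<And>X Y. X \<in> vector_fields \<A> \<Longrightarrow> Y \<in> vector_fields \<A> \<Longrightarrow> F (X + Y) = F X + F Y"
    and scale: "\<And>f X. f \<in> smooth_functions \<A> \<Longrightarrow> X \<in> vector_fields \<A> \<Longrightarrow>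
      F (\<lambda>q. scale (f q) (X q)) = scale (f p) (F X)"
    and X: "X \<in> vector_fields \<A>" and Y: "Y \<in> vector_fields \<A>" and eq: "X p = Y p"
  shows "F X = F Y"
proof -
  obtain \<beta> E where \<beta>: "\<beta> \<in> smooth_functions \<A>" "\<beta> p \<noteq> 0" and E: "\<forall>i::'e. E i \<in> vector_fields \<A>"
    and "\<forall>v\<in>tangent_space \<A> p. \<exists>u. v = (\<Sum>i\<in>Basis. scale (u i) (E i p))"
    and frame: "\<forall>X\<in>vector_fields \<A>. \<exists>c. (\<forall>i. c i \<in> smooth_functions \<A> \<and> (X p = 0 \<longrightarrow> c i p = 0)) \<and>
      (\<forall>q. scale (\<beta> q) (X q) = (\<Sum>i\<in>Basis. scale (c i q) (E i q)))"
    by (rule local_frame[of p])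
  let ?Z = "X - Y"
  have Z: "?Z \<in> vector_fields \<A>" "?Z p = 0"
    using X Y eq by (simp_all add: vector_fields_diff)
  obtain c where c: "\<And>i. c i \<in> smooth_functions \<A>" "\<And>i. c i p = 0"
    and sum: "\<And>q. scale (\<beta> q) (?Z q) = (\<Sum>i\<in>Basis. scale (c i q) (E i q))"
    using bspec[OF frame Z(1)] Z(2) by blast
  have F_zero: "F 0 = 0"
    using add[OF vector_fields_zero vector_fields_zero] by simp
  have cE: "(\<lambda>q. scale (c i q) (E i q)) \<in> vector_fields \<A>" for i
    by (intro vector_fields_scale c E[rule_format])
  have F_sum: "F (\<Sum>i\<in>I. (\<lambda>q. scale (c i q) (E i q))) = 0" for I
  proof (induction I rule: infinite_finite_induct)
    case (insert i I)
    have "F (\<lambda>q. scale (c i q) (E i q)) = 0"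
      by (simp only: scale[OF c(1) E[rule_format]] c(2) tvec_scale_zero_left)
    moreover have "(\<Sum>i\<in>I. (\<lambda>q. scale (c i q) (E i q))) \<in> vector_fields \<A>"
      by (rule vector_fields_sum) (rule cE)
    ultimately show ?case
      by (simp only: sum.insert[OF insert.hyps] add[OF cE] insert.IH add_0)
  qed (simp_all only: F_zero sum.empty sum.infinite not_False_eq_True)
  have "(\<Sum>i\<in>I. (\<lambda>q. scale (c i q) (E i q))) q = (\<Sum>i\<in>I. scale (c i q) (E i q))" for I q
    by (induction I rule: infinite_finite_induct) simp_all
  then have "(\<lambda>q. scale (\<beta> q) (?Z q)) = (\<Sum>i\<in>Basis. (\<lambda>q. scale (c i q) (E i q)))"
    using sum by (auto simp only: fun_eq_iff)
  then have "scale (\<beta> p) (F ?Z) = 0"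
    unfolding scale[OF \<beta>(1) Z(1), symmetric] by (simp only: F_sum)
  then have "F ?Z = 0"
    using \<beta>(2) by (simp add: scale_def fun_eq_iff)
  then show ?thesis
    using add[OF Z(1) Y] by simp
qed

lemmas vector_field_const = tangent_const[OF vector_fields_tangent]
lemmas vector_field_plus = tangent_plus[OF vector_fields_tangent]
lemmas vector_field_minus = tangent_minus[OF vector_fields_tangent]
lemmas vector_field_diff = tangent_diff[OF vector_fields_tangent]
lemmas vector_field_mult = tangent_mult[OF vector_fields_tangent]

end

section \<open>Curvature of the Levi-Civita connection\<close>

text \<open>With these symmetries A becomes K(w,x,y,z) - K(x,y,w,z) and B becomes - K(w,x,y,z) +
  K(y,w,x,z); the Bianchi identity turns the difference into 3 K(w,x,y,z). The laws are relative to
  \<open>V\<close> because the curvature obeys them only on tangent vectors, which do not fill their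
  type.\<close>

lemma polarization:
  fixes K :: "'v::plus \<Rightarrow> 'v \<Rightarrow> 'v \<Rightarrow> 'v \<Rightarrow> real" and V :: "'v set"
  assumes closed: "\<And>a b. a \<in> V \<Longrightarrow> b \<in> V \<Longrightarrow> a + b \<in> V"
    and add: "\<And>a a' b c d. \<lbrakk>a \<in> V; a' \<in> V; b \<in> V; c \<in> V; d \<in> V\<rbrakk> \<Longrightarrow> K (a + a') b c d = K a b c d + K a' b c d"
    and swap: "\<And>a b c d. \<lbrakk>a \<in> V; b \<in> V; c \<in> V; d \<in> V\<rbrakk> \<Longrightarrow> K a b c d = - K b a c d"
    and pair: "\<And>a b c d. \<lbrakk>a \<in> V; b \<in> V; c \<in> V; d \<in> V\<rbrakk> \<Longrightarrow> K a b c d = K c d a b"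
    and Bianchi: "\<And>a b c d. \<lbrakk>a \<in> V; b \<in> V; c \<in> V; d \<in> V\<rbrakk> \<Longrightarrow> K a b c d + K b c a d + K c a b d = 0"
    and diag: "\<And>a b. a \<in> V \<Longrightarrow> b \<in> V \<Longrightarrow> T a b = K a b a b"
    and V [simp]: "w \<in> V" "x \<in> V" "y \<in> V" "z \<in> V"
  shows "expr_A T w x y z - expr_B T w x y z = 3 * K w x y z"
proof -
  note [simp] = closed
  have add2: "K a (b + b') c d = K a b c d + K a b' c d"
    if "a \<in> V" "b \<in> V" "b' \<in> V" "c \<in> V" "d \<in> V" for a b b' c d
    using add[of b b' a c d] swap[of a "b + b'" c d] swap[of a b c d] swap[of a b' c d] that by simp
  have add3: "K a b (c + c') d = K a b c d + K a b c' d"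
    if "a \<in> V" "b \<in> V" "c \<in> V" "c' \<in> V" "d \<in> V" for a b c c' d
    using add[of c c' d a b] pair[of a b "c + c'" d] pair[of a b c d] pair[of a b c' d] that by simp
  have add4: "K a b c (d + d') = K a b c d + K a b c d'"
    if "a \<in> V" "b \<in> V" "c \<in> V" "d \<in> V" "d' \<in> V" for a b c d d'
    using add2[of c d d' a b] pair[of a b c "d + d'"] pair[of a b c d] pair[of a b c d'] that by simp
  \<comment> \<open>Inclusion-exclusion keeps those terms of K(w+y, z+x, w+y, z+x) in which each of
    the four vectors occurs once; B does the same for K(w+z, x+y, w+z, x+y).\<close>
  have "2 * expr_A T w x y z = K w x y z + K w z y x + K y x w z + K y z w x"
    by (simp add: expr_A_def diag add add2 add3 add4)
  moreover have "2 * expr_B T w x y z = K w x z y + K w y z x + K z x w y + K z y w x"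
    by (simp add: expr_B_def diag add add2 add3 add4)
  moreover have "K y x w z = K w z y x" "K y z w x = K w x y z" "K z x w y = K w y z x" "K z y w x = K w x z y"
      "K y w z x = K z x y w" "K x z y w = K y w x z"
    by (rule pair; simp)+
  moreover have "K z y w x = - K y z w x" "K y x w z = - K x y w z" "K w y z x = - K y w z x"
      "K z x y w = - K x z y w"
    by (rule swap; simp)+
  moreover have "K w x y z + K x y w z + K y w x z = 0"
    by (rule Bianchi; simp)
  ultimately show ?thesis by linarith
qed

context riemannian_manifold
begin

lemma g_add_right: "\<lbrakk>u \<in> tangent_space \<A> p; v \<in> tangent_space \<A> p; w \<in> tangent_space \<A> p\<rbrakk>
    \<Longrightarrow> g p w (u + v) = g p w u + g p w v"
  using g_add[of u p v w] by (simp add: g_sym[of w] tangent_space_add)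

lemma g_scale_right: "\<lbrakk>v \<in> tangent_space \<A> p; w \<in> tangent_space \<A> p\<rbrakk>
    \<Longrightarrow> g p w (scale c v) = c * g p w v"
  using g_scale[of v p w c] by (simp add: g_sym[of w] tangent_space_scale)

lemma g_minus: "\<lbrakk>v \<in> tangent_space \<A> p; w \<in> tangent_space \<A> p\<rbrakk> \<Longrightarrow> g p (- v) w = - g p v w"
  using g_scale[of v p w "- 1"] by (simp add: tvec_scale_minus_one)

lemma g_minus_right: "\<lbrakk>v \<in> tangent_space \<A> p; w \<in> tangent_space \<A> p\<rbrakk> \<Longrightarrow> g p w (- v) = - g p w v"
  using g_scale_right[of v p w "- 1"] by (simp add: tvec_scale_minus_one)

lemma g_diff: "\<lbrakk>u \<in> tangent_space \<A> p; v \<in> tangent_space \<A> p; w \<in> tangent_space \<A> p\<rbrakk>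
    \<Longrightarrow> g p (u - v) w = g p u w - g p v w"
  using g_add[of u p "- v" w] by (simp add: g_minus tangent_space_minus)

lemma g_diff_right: "\<lbrakk>u \<in> tangent_space \<A> p; v \<in> tangent_space \<A> p; w \<in> tangent_space \<A> p\<rbrakk>
    \<Longrightarrow> g p w (u - v) = g p w u - g p w v"
  using g_add_right[of u p "- v" w] by (simp add: g_minus_right tangent_space_minus)

lemma g_zero: "w \<in> tangent_space \<A> p \<Longrightarrow> g p 0 w = 0"
  using g_scale[of 0 p w 0] by (simp add: tvec_scale_zero_left tangent_space_zero)

lemmas tangent_closed = tangent_space_add tangent_space_diff tangent_space_minus tangent_space_scale
  tangent_space_zero vector_fields_tangent

lemmas g_linear = g_add g_add_right g_diff g_diff_right g_minus g_minus_right g_scale g_scale_right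

end

context levi_civita
begin

section \<open>The connection as an operator on vector fields\<close>

definition D :: "'a vfield \<Rightarrow> 'a vfield \<Rightarrow> 'a vfield" where
  "D X Y = (\<lambda>q. nabla q (X q) Y)"

lemma nabla_minus_left: "\<lbrakk>v \<in> tangent_space \<A> p; Y \<in> vector_fields \<A>\<rbrakk> \<Longrightarrow> nabla p (- v) Y = - nabla p v Y"
  using nabla_scale_left[of v p Y "- 1"] by (simp add: tvec_scale_minus_one)

lemma nabla_diff_left: "\<lbrakk>u \<in> tangent_space \<A> p; v \<in> tangent_space \<A> p; Y \<in> vector_fields \<A>\<rbrakk>
    \<Longrightarrow> nabla p (u - v) Y = nabla p u Y - nabla p v Y"
  using nabla_add_left[of u p "- v" Y] by (simp add: nabla_minus_left tangent_space_minus)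

lemma nabla_diff_right: "\<lbrakk>v \<in> tangent_space \<A> p; Y \<in> vector_fields \<A>; Z \<in> vector_fields \<A>\<rbrakk>
    \<Longrightarrow> nabla p v (Y - Z) = nabla p v Y - nabla p v Z"
  using nabla_add_right[of v p "Y - Z" Z] by (simp add: vector_fields_diff)

lemma D_vector_field: "X \<in> vector_fields \<A> \<Longrightarrow> Y \<in> vector_fields \<A> \<Longrightarrow> D X Y \<in> vector_fields \<A>"
  unfolding D_def by (rule nabla_smooth)

lemma lie_bracket_eq:
  "X \<in> vector_fields \<A> \<Longrightarrow> Y \<in> vector_fields \<A> \<Longrightarrow> lie_bracket X Y = D X Y - D Y X"
  unfolding D_def using nabla_torsion_free by (simp add: fun_eq_iff)

text \<open>Torsion-freeness spares the chart computation in which the second-order parts of the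
  commutator cancel.\<close>

lemma lie_bracket_vector_field:
  "X \<in> vector_fields \<A> \<Longrightarrow> Y \<in> vector_fields \<A> \<Longrightarrow> lie_bracket X Y \<in> vector_fields \<A>"
  by (simp add: lie_bracket_eq vector_fields_diff D_vector_field)

lemma D_add_left:
  "\<lbrakk>X \<in> vector_fields \<A>; Y \<in> vector_fields \<A>; Z \<in> vector_fields \<A>\<rbrakk> \<Longrightarrow> D (X + Y) Z = D X Z + D Y Z"
  by (rule ext) (simp only: D_def plus_fun_apply nabla_add_left vector_fields_tangent)

lemma D_add_right:
  "\<lbrakk>X \<in> vector_fields \<A>; Y \<in> vector_fields \<A>; Z \<in> vector_fields \<A>\<rbrakk> \<Longrightarrow> D X (Y + Z) = D X Y + D X Z"
  by (rule ext) (simp only: D_def plus_fun_apply nabla_add_right vector_fields_tangent)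

lemma D_diff_right:
  "\<lbrakk>X \<in> vector_fields \<A>; Y \<in> vector_fields \<A>; Z \<in> vector_fields \<A>\<rbrakk> \<Longrightarrow> D X (Y - Z) = D X Y - D X Z"
  by (rule ext) (simp only: D_def minus_apply nabla_diff_right vector_fields_tangent)

lemma D_scale_left:
  "\<lbrakk>X \<in> vector_fields \<A>; Y \<in> vector_fields \<A>\<rbrakk>
    \<Longrightarrow> D (\<lambda>q. scale (f q) (X q)) Y = (\<lambda>q. scale (f q) (D X Y q))"
  by (rule ext) (simp only: D_def nabla_scale_left vector_fields_tangent)

lemma D_scale_right:
  "\<lbrakk>X \<in> vector_fields \<A>; Y \<in> vector_fields \<A>; f \<in> smooth_functions \<A>\<rbrakk>
    \<Longrightarrow> D X (\<lambda>q. scale (f q) (Y q)) = (\<lambda>q. scale (X q f) (Y q)) + (\<lambda>q. scale (f q) (D X Y q))"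
  by (rule ext) (simp only: D_def nabla_Leibniz vector_fields_tangent plus_fun_apply)

lemma D_metric:
  "\<lbrakk>X \<in> vector_fields \<A>; Y \<in> vector_fields \<A>; Z \<in> vector_fields \<A>\<rbrakk>
    \<Longrightarrow> X p (\<lambda>q. g q (Y q) (Z q)) = g p (D X Y p) (Z p) + g p (Y p) (D X Z p)"
  by (simp only: D_def nabla_metric vector_fields_tangent)

section \<open>Tensoriality of the curvature\<close>

lemma curvature_field_eq:
  "curvature_field nabla X Y Z = D X (D Y Z) - D Y (D X Z) - D (lie_bracket X Y) Z"
  by (rule ext) (simp only: D_def curvature_field_def minus_apply)

lemma curvature_field_tangent:
  "\<lbrakk>X \<in> vector_fields \<A>; Y \<in> vector_fields \<A>; Z \<in> vector_fields \<A>\<rbrakk>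
    \<Longrightarrow> curvature_field nabla X Y Z p \<in> tangent_space \<A> p"
  by (intro vector_fields_tangent)
    (simp only: curvature_field_eq vector_fields_diff D_vector_field lie_bracket_vector_field)

lemma curvature_field_swap:
  "\<lbrakk>X \<in> vector_fields \<A>; Y \<in> vector_fields \<A>; Z \<in> vector_fields \<A>\<rbrakk>
    \<Longrightarrow> curvature_field nabla X Y Z p = - curvature_field nabla Y X Z p"
  unfolding curvature_field_eq lie_bracket_eq
  by (simp add: D_def nabla_diff_left nabla_tangent vector_fields_tangent)

lemma curvature_field_tensorial_right:
  assumes X: "X \<in> vector_fields \<A>" and Y: "Y \<in> vector_fields \<A>"
    and Z: "Z \<in> vector_fields \<A>" "Z' \<in> vector_fields \<A>" "Z p = Z' p"
  shows "curvature_field nabla X Y Z p = curvature_field nabla X Y Z' p"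
proof (rule tensorial[where F = "\<lambda>Z. curvature_field nabla X Y Z p", OF _ _ Z])
  note [simp] = X Y lie_bracket_vector_field[OF X Y] D_vector_field vector_fields_tangent
  fix Z Z' assume [simp]: "Z \<in> vector_fields \<A>" "Z' \<in> vector_fields \<A>"
  show "curvature_field nabla X Y (Z + Z') p = curvature_field nabla X Y Z p + curvature_field nabla X Y Z' p"
    by (simp add: curvature_field_eq D_add_right)
next
  note [simp] = X Y lie_bracket_vector_field[OF X Y] D_vector_field vector_fields_tangent
  fix f Z assume f [simp]: "f \<in> smooth_functions \<A>" and Z [simp]: "Z \<in> vector_fields \<A>"
  \<comment> \<open>After antisymmetrizing in \<open>V\<close> and \<open>W\<close> the cross terms
    cancel, and the second derivatives of \<open>f\<close> leave the bracket applied to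
    \<open>f\<close>, which the last term of the curvature removes.\<close>
  have D2: "D V (D W (\<lambda>q. scale (f q) (Z q))) p =
      (scale (V p (\<lambda>q. W q f)) (Z p) + scale (W p f) (D V Z p)) + (scale (V p f) (D W Z p) + scale (f p) (D V (D W Z) p))"
    if [simp]: "V \<in> vector_fields \<A>" "W \<in> vector_fields \<A>" for V W
  proof -
    have [simp]: "(\<lambda>q. W q f) \<in> smooth_functions \<A>"
      by (rule vector_fields_smooth) simp_all
    have "(\<lambda>q. scale (W q f) (Z q)) \<in> vector_fields \<A>" "(\<lambda>q. scale (f q) (D W Z q)) \<in> vector_fields \<A>"
      by (rule vector_fields_scale; simp)+
    then show ?thesis
      by (simp only: D_scale_right that Z f D_add_right D_vector_field \<open>(\<lambda>q. W q f) \<in> smooth_functions \<A>\<close> plus_fun_apply)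
  qed
  have lie: "lie_bracket X Y p f = X p (\<lambda>q. Y q f) - Y p (\<lambda>q. X q f)"
    by (simp add: lie_bracket_def)
  show "curvature_field nabla X Y (\<lambda>q. scale (f q) (Z q)) p = scale (f p) (curvature_field nabla X Y Z p)"
    unfolding curvature_field_eq minus_apply D2[OF X Y] D2[OF Y X]
      D_scale_right[OF lie_bracket_vector_field[OF X Y] Z f]
    by (rule ext) (simp add: scale_apply lie algebra_simps)
qed

lemma curvature_field_tensorial_left:
  assumes Y: "Y \<in> vector_fields \<A>" and Z: "Z \<in> vector_fields \<A>"
    and X: "X \<in> vector_fields \<A>" "X' \<in> vector_fields \<A>" "X p = X' p"
  shows "curvature_field nabla X Y Z p = curvature_field nabla X' Y Z p"
proof (rule tensorial[where F = "\<lambda>X. curvature_field nabla X Y Z p", OF _ _ X])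
  note [simp] = Y Z D_vector_field vector_fields_tangent nabla_tangent
  fix X X' assume [simp]: "X \<in> vector_fields \<A>" "X' \<in> vector_fields \<A>"
  have [simp]: "X + X' \<in> vector_fields \<A>"
    by (simp add: vector_fields_add)
  have "lie_bracket (X + X') Y = lie_bracket X Y + lie_bracket X' Y"
    by (simp add: lie_bracket_eq D_add_left D_add_right)
  then show "curvature_field nabla (X + X') Y Z p = curvature_field nabla X Y Z p + curvature_field nabla X' Y Z p"
    by (simp add: curvature_field_eq D_add_right D_add_left lie_bracket_vector_field)
next
  note [simp] = Y Z D_vector_field vector_fields_tangent nabla_tangent
  fix f X assume f [simp]: "f \<in> smooth_functions \<A>" and X [simp]: "X \<in> vector_fields \<A>"
  have fX [simp]: "(\<lambda>q. scale (f q) (X q)) \<in> vector_fields \<A>"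
    by (rule vector_fields_scale; simp)
  \<comment> \<open>The extra term - (Yf) X of the bracket compensates the derivative of
    \<open>f\<close> that arises in D_Y (f D_X Z).\<close>
  have "lie_bracket (\<lambda>q. scale (f q) (X q)) Y p = scale (f p) (lie_bracket X Y p) - scale (Y p f) (X p)"
    by (intro ext) (simp add: lie_bracket_eq D_scale_left D_scale_right scale_apply algebra_simps)
  then have lie: "D (lie_bracket (\<lambda>q. scale (f q) (X q)) Y) Z p =
      scale (f p) (D (lie_bracket X Y) Z p) - scale (Y p f) (D X Z p)"
    by (simp add: D_def nabla_diff_left nabla_scale_left tangent_space_scale lie_bracket_vector_field)
  show "curvature_field nabla (\<lambda>q. scale (f q) (X q)) Y Z p = scale (f p) (curvature_field nabla X Y Z p)"
    unfolding curvature_field_eq minus_apply lie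
    by (rule ext) (simp add: D_scale_left D_scale_right scale_apply algebra_simps)
qed

text \<open>The extensions chosen by \<open>extend\<close> are exchanged for the given fields one
  slot at a time; the second slot is brought to the front by skewness.\<close>

lemma curvature_eq:
  assumes X: "X \<in> vector_fields \<A>" and Y: "Y \<in> vector_fields \<A>" and Z: "Z \<in> vector_fields \<A>"
  shows "curvature \<A> g nabla p (X p) (Y p) (Z p) w = g p (curvature_field nabla X Y Z p) w"
proof -
  let ?X = "extend \<A> p (X p)" and ?Y = "extend \<A> p (Y p)" and ?Z = "extend \<A> p (Z p)"
  note ext_X = extend_vector_field[OF vector_fields_tangent[OF X, of p]]
  note ext_Y = extend_vector_field[OF vector_fields_tangent[OF Y, of p]]
  note ext_Z = extend_vector_field[OF vector_fields_tangent[OF Z, of p]]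
  have "curvature_field nabla ?X ?Y ?Z p = curvature_field nabla X ?Y ?Z p"
    by (rule curvature_field_tensorial_left) (use X ext_X ext_Y ext_Z in simp_all)
  also have "\<dots> = - curvature_field nabla ?Y X ?Z p"
    by (rule curvature_field_swap) (use X ext_Y ext_Z in simp_all)
  also have "curvature_field nabla ?Y X ?Z p = curvature_field nabla Y X ?Z p"
    by (rule curvature_field_tensorial_left) (use X Y ext_Y ext_Z in simp_all)
  also have "- curvature_field nabla Y X ?Z p = curvature_field nabla X Y ?Z p"
    by (rule curvature_field_swap[symmetric]) (use X Y ext_Z in simp_all)
  also have "\<dots> = curvature_field nabla X Y Z p"
    by (rule curvature_field_tensorial_right) (use X Y Z ext_Z in simp_all)
  finally show ?thesis
    by (simp add: curvature_def)
qed

section \<open>Symmetries of the curvature\<close>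

lemma curvature_field_metric:
  assumes X [simp]: "X \<in> vector_fields \<A>" and Y [simp]: "Y \<in> vector_fields \<A>"
    and Z [simp]: "Z \<in> vector_fields \<A>" and W [simp]: "W \<in> vector_fields \<A>"
  shows "g p (curvature_field nabla X Y Z p) (W p) = - g p (curvature_field nabla X Y W p) (Z p)"
proof -
  note [simp] = D_vector_field vector_fields_tangent lie_bracket_vector_field
  let ?h = "\<lambda>q. g q (Z q) (W q)"
  \<comment> \<open>The operator XY - YX - [X,Y] annihilates \<open>?h\<close>. In its expansion the
    products of two first derivatives are symmetric and cancel, which leaves the two curvature
    terms.\<close>
  have second: "U p (\<lambda>q. V q ?h) =
      g p (D U (D V Z) p) (W p) + g p (D V Z p) (D U W p) + (g p (D U Z p) (D V W p) + g p (Z p) (D U (D V W) p))"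
    if [simp]: "U \<in> vector_fields \<A>" "V \<in> vector_fields \<A>" for U V
  proof -
    have "U p (\<lambda>q. V q ?h) = U p (\<lambda>q. g q (D V Z q) (W q) + g q (Z q) (D V W q))"
      by (simp add: D_metric)
    also have "\<dots> = U p (\<lambda>q. g q (D V Z q) (W q)) + U p (\<lambda>q. g q (Z q) (D V W q))"
      by (rule vector_field_plus[OF _ g_smooth g_smooth]) simp_all
    finally show ?thesis by (simp add: D_metric)
  qed
  have "lie_bracket X Y p ?h = g p (D (lie_bracket X Y) Z p) (W p) + g p (Z p) (D (lie_bracket X Y) W p)"
    by (rule D_metric) simp_all
  then have "X p (\<lambda>q. Y q ?h) - Y p (\<lambda>q. X q ?h) =
      g p (D (lie_bracket X Y) Z p) (W p) + g p (Z p) (D (lie_bracket X Y) W p)"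
    by (simp add: lie_bracket_def)
  then show ?thesis
    unfolding second[OF X Y] second[OF Y X] curvature_field_eq
    by (simp add: g_diff tangent_space_diff g_sym[of "Z p" p])
qed

lemma lie_bracket_Jacobi:
  assumes [simp]: "X \<in> vector_fields \<A>" "Y \<in> vector_fields \<A>" "Z \<in> vector_fields \<A>"
  shows "lie_bracket X (lie_bracket Y Z) p + lie_bracket Y (lie_bracket Z X) p
    + lie_bracket Z (lie_bracket X Y) p = 0"
proof
  fix f
  note [simp] = vector_fields_tangent lie_bracket_vector_field
  show "(lie_bracket X (lie_bracket Y Z) p + lie_bracket Y (lie_bracket Z X) p
    + lie_bracket Z (lie_bracket X Y) p) f = 0 f"
  proof (cases "f \<in> smooth_functions \<A>")
    case True
    have *: "U p (\<lambda>q. V q (\<lambda>r. W r f) - W q (\<lambda>r. V r f)) =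
        U p (\<lambda>q. V q (\<lambda>r. W r f)) - U p (\<lambda>q. W q (\<lambda>r. V r f))"
      if U: "U \<in> vector_fields \<A>" and V: "V \<in> vector_fields \<A>" and W: "W \<in> vector_fields \<A>" for U V W
      by (rule vector_field_diff[OF U vector_fields_smooth[OF V vector_fields_smooth[OF W True]]
            vector_fields_smooth[OF W vector_fields_smooth[OF V True]]])
    show ?thesis
      by (simp add: lie_bracket_def *[of X Y Z] *[of Y Z X] *[of Z X Y])
  next
    \<comment> \<open>Tangent vectors are 0 on non-smooth functions by convention, and the sum of
      brackets is a tangent vector.\<close>
    case False
    have "v f = 0" if v: "v \<in> tangent_space \<A> p" for v
    proof -
      obtain U \<phi> where U: "(U, \<phi>) \<in> \<A>" "p \<in> U" by (rule ex_chart)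
      obtain u where "v = directional_derivative \<A> (U, \<phi>) p u"
        by (rule tangent_in_chart[OF v U])
      then show ?thesis
        by (simp add: directional_derivative_nonsmooth[OF False])
    qed
    from this[of "lie_bracket X (lie_bracket Y Z) p + lie_bracket Y (lie_bracket Z X) p
        + lie_bracket Z (lie_bracket X Y) p"]
    show ?thesis by (simp add: tangent_space_add)
  qed
qed

text \<open>Grouping the cyclic sum by the outer derivative, torsion-freeness turns each group into
  an iterated bracket, so the sum vanishes by the Jacobi identity.\<close>

lemma Bianchi:
  assumes [simp]: "X \<in> vector_fields \<A>" "Y \<in> vector_fields \<A>" "Z \<in> vector_fields \<A>"
  shows "curvature_field nabla X Y Z p + curvature_field nabla Y Z X p + curvature_field nabla Z X Y p = 0"
proof -
  have *: "D X (D Y Z) p - D X (D Z Y) p - D (lie_bracket Y Z) X p = lie_bracket X (lie_bracket Y Z) p"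
    if [simp]: "X \<in> vector_fields \<A>" "Y \<in> vector_fields \<A>" "Z \<in> vector_fields \<A>" for X Y Z
  proof -
    have "D X (lie_bracket Y Z) p = D X (D Y Z) p - D X (D Z Y) p"
      by (simp add: lie_bracket_eq D_diff_right D_vector_field)
    moreover have "lie_bracket X (lie_bracket Y Z) p = D X (lie_bracket Y Z) p - D (lie_bracket Y Z) X p"
      using lie_bracket_eq[of X "lie_bracket Y Z"] lie_bracket_vector_field[of Y Z] by simp
    ultimately show ?thesis by simp
  qed
  show ?thesis
    using lie_bracket_Jacobi[of X Y Z p] *[of X Y Z] *[of Y Z X] *[of Z X Y]
    by (simp add: curvature_field_eq algebra_simps)
qed

lemma curvature_extend:
  "curvature \<A> g nabla p x y z w =
    g p (curvature_field nabla (extend \<A> p x) (extend \<A> p y) (extend \<A> p z) p) w"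
  by (simp add: curvature_def)

lemma curvature_swap:
  assumes "x \<in> tangent_space \<A> p" "y \<in> tangent_space \<A> p" "z \<in> tangent_space \<A> p" "w \<in> tangent_space \<A> p"
  shows "curvature \<A> g nabla p x y z w = - curvature \<A> g nabla p y x z w"
  unfolding curvature_extend
    curvature_field_swap[OF extend_vector_field(1) extend_vector_field(1) extend_vector_field(1), OF assms(1-3)]
  by (rule g_minus) (simp_all add: curvature_field_tangent extend_vector_field assms)

lemma curvature_metric:
  assumes "x \<in> tangent_space \<A> p" "y \<in> tangent_space \<A> p" "z \<in> tangent_space \<A> p" "w \<in> tangent_space \<A> p"
  shows "curvature \<A> g nabla p x y z w = - curvature \<A> g nabla p x y w z"
  using curvature_field_metric[of "extend \<A> p x" "extend \<A> p y" "extend \<A> p z" "extend \<A> p w" p]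
  by (simp add: curvature_extend extend_vector_field assms)

lemma curvature_Bianchi:
  assumes "x \<in> tangent_space \<A> p" "y \<in> tangent_space \<A> p" "z \<in> tangent_space \<A> p" "w \<in> tangent_space \<A> p"
  shows "curvature \<A> g nabla p x y z w + curvature \<A> g nabla p y z x w + curvature \<A> g nabla p z x y w = 0"
proof -
  let ?R = "\<lambda>x y z. curvature_field nabla (extend \<A> p x) (extend \<A> p y) (extend \<A> p z) p"
  have "?R x y z + ?R y z x + ?R z x y = 0"
    by (rule Bianchi) (simp_all add: extend_vector_field assms)
  then have "g p (?R x y z + ?R y z x + ?R z x y) w = 0"
    using assms by (simp only: g_zero)
  then show ?thesis
    by (simp add: curvature_extend g_add tangent_space_add curvature_field_tangent extend_vector_field assms)
qed

lemma curvature_pair: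
  assumes [simp]: "x \<in> tangent_space \<A> p" "y \<in> tangent_space \<A> p" "z \<in> tangent_space \<A> p" "w \<in> tangent_space \<A> p"
  shows "curvature \<A> g nabla p x y z w = curvature \<A> g nabla p z w x y"
proof -
  let ?K = "curvature \<A> g nabla p"
  note B = curvature_Bianchi and s = curvature_swap and m = curvature_metric
  \<comment> \<open>The first two identities minus the last two leave 2 K(x,y,z,w) - 2
    K(z,w,x,y).\<close>
  have "?K x y z w + ?K y z x w + ?K z x y w = 0" "?K y z w x + ?K z w y x + ?K w y z x = 0"
    "?K z w x y + ?K w x z y + ?K x z w y = 0" "?K w x y z + ?K x y w z + ?K y w x z = 0"
    by (rule B; simp)+
  moreover have "?K y z w x = - ?K y z x w" "?K z w y x = - ?K z w x y" "?K w x z y = - ?K w x y z"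
    "?K x y w z = - ?K x y z w"
    by (rule m; simp)+
  moreover have "?K w y z x = - ?K y w z x" "?K x z w y = - ?K z x w y"
    by (rule s; simp)+
  moreover have "?K y w z x = - ?K y w x z" "?K z x w y = - ?K z x y w"
    by (rule m; simp)+
  ultimately show ?thesis by linarith
qed

lemma curvature_add_right:
  assumes "x \<in> tangent_space \<A> p" "y \<in> tangent_space \<A> p" "z \<in> tangent_space \<A> p"
    "w \<in> tangent_space \<A> p" "w' \<in> tangent_space \<A> p"
  shows "curvature \<A> g nabla p x y z (w + w') = curvature \<A> g nabla p x y z w + curvature \<A> g nabla p x y z w'"
  by (simp add: curvature_extend g_add_right curvature_field_tangent extend_vector_field assms)

text \<open>The extension chosen for a sum need not be the sum of the chosen extensions. The pair
  symmetry moves the first slot to the last one, which enters only through \<open>g\<close>.\<close>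

lemma curvature_add_left:
  assumes [simp]: "x \<in> tangent_space \<A> p" "x' \<in> tangent_space \<A> p" "y \<in> tangent_space \<A> p"
    "z \<in> tangent_space \<A> p" "w \<in> tangent_space \<A> p"
  shows "curvature \<A> g nabla p (x + x') y z w = curvature \<A> g nabla p x y z w + curvature \<A> g nabla p x' y z w"
proof -
  have "curvature \<A> g nabla p u y z w = - curvature \<A> g nabla p z w y u" if "u \<in> tangent_space \<A> p" for u
    using curvature_pair[of u p y z w] curvature_metric[of z p w u y] that by simp
  then show ?thesis
    by (simp add: curvature_add_right tangent_space_add)
qed

end

section \<open>Nearly cosymplectic structures\<close>

context almost_contact_metric_manifold
begin

lemma xi_tangent: "\<xi> p \<in> tangent_space \<A> p"
  by (rule vector_fields_tangent[OF xi_field])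

lemma theta_minus: "v \<in> tangent_space \<A> p \<Longrightarrow> \<theta> p (- v) = - \<theta> p v"
  using theta_scale[of v p "- 1"] by (simp add: tvec_scale_minus_one)

lemma theta_diff: "\<lbrakk>v \<in> tangent_space \<A> p; w \<in> tangent_space \<A> p\<rbrakk> \<Longrightarrow> \<theta> p (v - w) = \<theta> p v - \<theta> p w"
  using theta_add[of v p "- w"] by (simp add: theta_minus tangent_space_minus)

lemma theta_zero: "\<theta> p 0 = 0"
  using theta_diff[of 0 p 0] tangent_space_zero by simp

lemma theta_xi: "\<theta> p (\<xi> p) = 0"
proof (rule ccontr)
  assume "\<theta> p (\<xi> p) \<noteq> 0"
  then have "g p (\<theta> p (\<xi> p)) (\<theta> p (\<xi> p)) > 0"
    by (rule g_pos[OF theta_tangent[OF xi_tangent]])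
  then show False
    by (simp add: compatible xi_tangent xi_unit eta_xi)
qed

lemma eta_eq: "v \<in> tangent_space \<A> p \<Longrightarrow> \<eta> p v = g p v (\<xi> p)"
  using compatible[OF _ xi_tangent, of v p] g_zero[OF theta_tangent, of v p] g_sym[of 0 p "\<theta> p v"]
  by (simp add: theta_xi eta_xi theta_tangent tangent_space_zero)

text \<open>Computing \<theta>^3 v as \<theta>^2 of \<theta>v and as \<theta> of \<theta>^2 v gives
  results that differ by \<eta>(\<theta>v) \<xi>, since \<theta>\<xi> = 0.\<close>

lemma g_theta_xi: "v \<in> tangent_space \<A> p \<Longrightarrow> g p (\<theta> p v) (\<xi> p) = 0"
proof -
  assume v [simp]: "v \<in> tangent_space \<A> p"
  note [simp] = theta_tangent xi_tangent tangent_closed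
  have "\<theta> p (\<theta> p (\<theta> p v)) = - \<theta> p v + scale (\<eta> p (\<theta> p v)) (\<xi> p)"
    by (rule theta_square) simp
  moreover have "\<theta> p (\<theta> p (\<theta> p v)) = - \<theta> p v"
    unfolding theta_square[OF v]
    by (simp add: theta_diff theta_scale theta_xi tvec_scale_zero_right)
  ultimately have "scale (\<eta> p (\<theta> p v)) (\<xi> p) = 0"
    by simp
  then have "g p (scale (\<eta> p (\<theta> p v)) (\<xi> p)) (\<xi> p) = 0"
    by (simp add: g_zero)
  then show ?thesis
    by (simp add: g_scale xi_unit eta_eq)
qed

lemma theta_theta: "v \<in> tangent_space \<A> p \<Longrightarrow> \<theta> p (\<theta> p v) = scale (g p v (\<xi> p)) (\<xi> p) - v"
  by (simp add: theta_square eta_eq)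

lemma g_theta_theta: "\<lbrakk>v \<in> tangent_space \<A> p; w \<in> tangent_space \<A> p\<rbrakk>
    \<Longrightarrow> g p (\<theta> p v) (\<theta> p w) = g p v w - g p v (\<xi> p) * g p w (\<xi> p)"
  by (simp add: compatible eta_eq)

lemma theta_skew:
  assumes [simp]: "v \<in> tangent_space \<A> p" "w \<in> tangent_space \<A> p"
  shows "g p (\<theta> p v) w = - g p v (\<theta> p w)"
proof -
  note [simp] = theta_tangent xi_tangent tangent_closed
  have "g p (\<theta> p (\<theta> p v)) (\<theta> p w) = g p (\<theta> p v) w"
    by (simp add: g_theta_theta[of "\<theta> p v" p w] g_theta_xi)
  then show ?thesis
    by (simp add: theta_theta g_linear g_sym[of "\<xi> p" p] g_theta_xi)
qed

end

context nearly_cosymplectic_manifold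
begin

section \<open>First-order identities for \<open>P\<close> and \<open>h\<close>\<close>

abbreviation Th :: "'a vfield \<Rightarrow> 'a vfield" where
  "Th X \<equiv> (\<lambda>q. \<theta> q (X q))"

abbreviation P :: "'a \<Rightarrow> 'a tvec \<Rightarrow> 'a tvec \<Rightarrow> 'a tvec" where
  "P \<equiv> nabla_endo \<A> nabla \<theta>"

abbreviation h :: "'a \<Rightarrow> 'a tvec \<Rightarrow> 'a tvec" where
  "h p x \<equiv> nabla p x \<xi>"

text \<open>The terms in which the Leibniz rule differentiates a coefficient cancel, because
  \<theta> is linear at each point; hence any field may replace the one chosen by
  \<open>extend\<close>.\<close>

lemma nabla_endo_eq:
  assumes v: "v \<in> tangent_space \<A> p" and W: "W \<in> vector_fields \<A>"
  shows "P p v (W p) = nabla p v (Th W) - \<theta> p (nabla p v W)"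
proof -
  let ?F = "\<lambda>W. nabla p v (Th W) - \<theta> p (nabla p v W)"
  have "?F (extend \<A> p (W p)) = ?F W"
  proof (rule tensorial[where F = ?F])
    fix X Y assume [simp]: "X \<in> vector_fields \<A>" "Y \<in> vector_fields \<A>"
    have "Th (X + Y) = Th X + Th Y"
      by (rule ext) (simp only: plus_fun_apply theta_add vector_fields_tangent \<open>X \<in> vector_fields \<A>\<close> \<open>Y \<in> vector_fields \<A>\<close>)
    then show "?F (X + Y) = ?F X + ?F Y"
      using v by (simp add: nabla_add_right theta_smooth theta_add nabla_tangent)
  next
    fix f X assume f [simp]: "f \<in> smooth_functions \<A>" and X [simp]: "X \<in> vector_fields \<A>"
    have "Th (\<lambda>q. scale (f q) (X q)) = (\<lambda>q. scale (f q) (Th X q))"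
      by (simp add: theta_scale vector_fields_tangent)
    then have "?F (\<lambda>q. scale (f q) (X q)) =
        (scale (v f) (\<theta> p (X p)) + scale (f p) (nabla p v (Th X)))
        - (scale (v f) (\<theta> p (X p)) + scale (f p) (\<theta> p (nabla p v X)))"
      using v by (simp add: nabla_Leibniz theta_smooth theta_add theta_scale nabla_tangent
          tangent_space_scale vector_fields_tangent)
    then show "?F (\<lambda>q. scale (f q) (X q)) = scale (f p) (?F X)"
      by (simp add: fun_eq_iff scale_apply algebra_simps)
  qed (simp_all add: extend_vector_field vector_fields_tangent W)
  then show ?thesis
    by (simp add: nabla_endo_def)
qed

lemma P_tangent: "\<lbrakk>x \<in> tangent_space \<A> p; y \<in> tangent_space \<A> p\<rbrakk> \<Longrightarrow> P p x y \<in> tangent_space \<A> p"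
  unfolding nabla_endo_def
  by (intro tangent_space_diff nabla_tangent theta_tangent theta_smooth) (simp_all add: extend_vector_field)

lemma h_tangent: "x \<in> tangent_space \<A> p \<Longrightarrow> h p x \<in> tangent_space \<A> p"
  by (rule nabla_tangent[OF _ xi_field])

lemmas [simp] = tangent_closed theta_tangent xi_tangent P_tangent h_tangent xi_field
  curvature_field_tangent nabla_tangent D_vector_field theta_smooth extend_vector_field vector_fields_diff

lemma P_diff_left: "\<lbrakk>x \<in> tangent_space \<A> p; x' \<in> tangent_space \<A> p; y \<in> tangent_space \<A> p\<rbrakk>
    \<Longrightarrow> P p (x - x') y = P p x y - P p x' y"
  unfolding nabla_endo_def by (simp add: nabla_diff_left theta_diff)

lemma P_swap: "\<lbrakk>x \<in> tangent_space \<A> p; y \<in> tangent_space \<A> p\<rbrakk> \<Longrightarrow> P p x y = - P p y x"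
  using nearly_cosymplectic[of x p y] by (simp add: eq_neg_iff_add_eq_0)

lemma P_self: "x \<in> tangent_space \<A> p \<Longrightarrow> P p x x = 0"
  using P_swap[of x p x] by (simp add: fun_eq_iff)

text \<open>Obtained by differentiating g(\<theta>Y, Z) = - g(Y, \<theta>Z) along
  \<open>x\<close>.\<close>

lemma P_skew:
  assumes [simp]: "x \<in> tangent_space \<A> p" "y \<in> tangent_space \<A> p" "z \<in> tangent_space \<A> p"
  shows "g p (P p x y) z = - g p y (P p x z)"
proof -
  define Y Z where YZ: "Y = extend \<A> p y" "Z = extend \<A> p z"
  have [simp]: "Y \<in> vector_fields \<A>" "Z \<in> vector_fields \<A>" "Y p = y" "Z p = z"
    by (simp_all add: YZ)
  have "(\<lambda>q. g q (Th Y q) (Z q)) = (\<lambda>q. - g q (Y q) (Th Z q))"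
    by (simp add: theta_skew)
  then have "x (\<lambda>q. g q (Th Y q) (Z q)) = x (\<lambda>q. - g q (Y q) (Th Z q))"
    by (simp only:)
  also have "\<dots> = - x (\<lambda>q. g q (Y q) (Th Z q))"
    by (rule tangent_minus[OF assms(1) g_smooth]) simp_all
  finally have "g p (nabla p x (Th Y)) z + g p (\<theta> p y) (nabla p x Z) =
      - (g p (nabla p x Y) (\<theta> p z) + g p y (nabla p x (Th Z)))"
    using nabla_metric[of x p "Th Y" Z] nabla_metric[of x p Y "Th Z"] by simp
  moreover have "nabla p x (Th Y) = P p x y + \<theta> p (nabla p x Y)" "nabla p x (Th Z) = P p x z + \<theta> p (nabla p x Z)"
    using nabla_endo_eq[of x p Y] nabla_endo_eq[of x p Z] by simp_all
  ultimately show ?thesis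
    by (simp add: g_linear theta_skew)
qed

lemma g_h_xi: "x \<in> tangent_space \<A> p \<Longrightarrow> g p (h p x) (\<xi> p) = 0"
  using nabla_metric[of x p \<xi> \<xi>] tangent_const[of x p 1] g_sym[of "\<xi> p" p "h p x"]
  by (simp add: xi_unit)

lemma P_xi_right: "x \<in> tangent_space \<A> p \<Longrightarrow> P p x (\<xi> p) = - \<theta> p (h p x)"
proof -
  assume x: "x \<in> tangent_space \<A> p"
  \<comment> \<open>The zero field is written as \<xi> - \<xi>, so that linearity of the connection
    makes its derivative vanish.\<close>
  have "nabla p x (\<xi> - \<xi>) = 0"
    using x nabla_diff_right[of x p \<xi> \<xi>] by simp
  moreover have "Th \<xi> = \<xi> - \<xi>"
    by (simp add: fun_eq_iff theta_xi)
  ultimately show ?thesis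
    using nabla_endo_eq[OF x xi_field] by simp
qed

text \<open>The derivative of \<theta>^2 = - Id + \<eta> \<otimes> \<xi>; the first two terms on the
  right come from \<eta> \<otimes> \<xi>.\<close>

lemma theta_P:
  assumes [simp]: "x \<in> tangent_space \<A> p" "y \<in> tangent_space \<A> p"
  shows "P p x (\<theta> p y) = scale (g p y (h p x)) (\<xi> p) + scale (g p y (\<xi> p)) (h p x) - \<theta> p (P p x y)"
proof -
  define Y where Y: "Y = extend \<A> p y"
  have [simp]: "Y \<in> vector_fields \<A>" "Y p = y"
    by (simp_all add: Y)
  let ?f = "\<lambda>q. g q (Y q) (\<xi> q)"
  have f [simp]: "?f \<in> smooth_functions \<A>"
    by (rule g_smooth) simp_all
  have f\<xi>: "(\<lambda>q. scale (?f q) (\<xi> q)) \<in> vector_fields \<A>"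
    by (rule vector_fields_scale[OF f xi_field])
  have "Th (Th Y) = (\<lambda>q. scale (?f q) (\<xi> q)) - Y"
    by (rule ext) (simp only: minus_apply theta_theta vector_fields_tangent \<open>Y \<in> vector_fields \<A>\<close>)
  then have "nabla p x (Th (Th Y)) = scale (x ?f) (\<xi> p) + scale (g p y (\<xi> p)) (h p x) - nabla p x Y"
    by (simp add: nabla_diff_right f\<xi> nabla_Leibniz)
  moreover have "x ?f = g p (nabla p x Y) (\<xi> p) + g p y (h p x)"
    using nabla_metric[of x p Y \<xi>] by simp
  moreover have "nabla p x (Th (Th Y)) = P p x (\<theta> p y) + \<theta> p (nabla p x (Th Y))"
    using nabla_endo_eq[of x p "Th Y"] by simp
  moreover have "nabla p x (Th Y) = P p x y + \<theta> p (nabla p x Y)"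
    using nabla_endo_eq[of x p Y] by simp
  ultimately show ?thesis
    by (simp add: theta_add theta_theta tvec_scale_add_left algebra_simps)
qed

lemma h_xi: "h p (\<xi> p) = 0"
proof -
  have "\<theta> p (h p (\<xi> p)) = 0"
    using P_xi_right[of "\<xi> p" p] P_self[of "\<xi> p" p] by simp
  then have "\<theta> p (\<theta> p (h p (\<xi> p))) = 0"
    by (simp only: theta_zero)
  then show ?thesis
    by (simp add: theta_theta g_h_xi tvec_scale_zero_left)
qed

lemma P_xi_left: "x \<in> tangent_space \<A> p \<Longrightarrow> P p (\<xi> p) x = \<theta> p (h p x)"
  using P_swap[of "\<xi> p" p x] P_xi_right[of x p] by simp

lemma g_zero_right: "v \<in> tangent_space \<A> p \<Longrightarrow> g p v 0 = 0"
  using g_zero g_sym[of v p 0] by simp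

text \<open>This is \<open>theta_P\<close> in the direction \<xi>, where \<open>P\<close> becomes
  \<theta> after h and the terms containing h\<xi> vanish.\<close>

lemma theta_h_theta:
  assumes [simp]: "x \<in> tangent_space \<A> p"
  shows "\<theta> p (h p (\<theta> p x)) = h p x"
  using theta_P[of "\<xi> p" p x]
  by (simp add: h_xi P_xi_left g_zero_right tvec_scale_zero_left tvec_scale_zero_right theta_theta g_h_xi)

lemma h_theta:
  assumes [simp]: "x \<in> tangent_space \<A> p"
  shows "h p (\<theta> p x) = - \<theta> p (h p x)"
proof -
  have "\<theta> p (\<theta> p (h p (\<theta> p x))) = \<theta> p (h p x)"
    by (simp only: theta_h_theta assms)
  then have "- h p (\<theta> p x) = \<theta> p (h p x)"
    by (simp add: theta_theta g_h_xi tvec_scale_zero_left)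
  then show ?thesis
    by (metis minus_minus)
qed

lemma g_P_xi:
  assumes [simp]: "x \<in> tangent_space \<A> p" "y \<in> tangent_space \<A> p"
  shows "g p (P p x y) (\<xi> p) = g p y (\<theta> p (h p x))"
  by (simp add: P_skew P_xi_right g_linear)

text \<open>The skewness of \<open>P\<close> at (\<theta>x, y), read in the \<xi>-component,
  compares g(y, hx) with - g(x, hy). Geometrically, \<xi> is a Killing field.\<close>

lemma h_skew:
  assumes [simp]: "x \<in> tangent_space \<A> p" "y \<in> tangent_space \<A> p"
  shows "g p (h p x) y = - g p x (h p y)"
proof -
  have "g p (P p (\<theta> p x) y) (\<xi> p) = - g p (P p y (\<theta> p x)) (\<xi> p)"
    by (subst P_swap) (simp_all add: g_linear)
  then have "g p y (h p x) = - g p (\<theta> p x) (\<theta> p (h p y))"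
    by (simp add: g_P_xi theta_h_theta)
  then show ?thesis
    by (simp add: g_theta_theta g_h_xi g_sym[of y p])
qed

text \<open>Tests \<open>theta_P\<close> against the metric. The case y = z will be differentiated
  along X; the polarized form then absorbs the terms in which Y itself is differentiated.\<close>

lemma g_P_theta:
  assumes [simp]: "x \<in> tangent_space \<A> p" "y \<in> tangent_space \<A> p" "z \<in> tangent_space \<A> p"
  shows "g p (P p x y) (\<theta> p z) + g p (P p x z) (\<theta> p y) =
    - g p y (\<xi> p) * g p z (h p x) - g p z (\<xi> p) * g p y (h p x)"
proof -
  have "g p (P p x y) (\<theta> p z) = - g p y (P p x (\<theta> p z))"
    by (simp add: P_skew)
  also have "\<dots> = - (g p z (h p x) * g p y (\<xi> p) + g p z (\<xi> p) * g p y (h p x) - g p y (\<theta> p (P p x z)))"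
    by (simp add: theta_P g_linear)
  also have "g p y (\<theta> p (P p x z)) = - g p (P p x z) (\<theta> p y)"
    by (simp add: g_sym[of y p] theta_skew)
  finally show ?thesis by (simp add: algebra_simps)
qed

section \<open>Second-order identities and the curvature\<close>

lemma D_xi: "D X \<xi> q = h q (X q)"
  by (simp add: D_def)

text \<open>The Killing identity for the second derivative of \<xi>; the left side is g((\<nabla>_X
  h)X, Y). Skewness of h is used twice: g(hY, X) = - g(Y, hX) is differentiated along X, and g(hX,
  X) = 0 along Y.\<close>

lemma second_derivative_xi:
  assumes [simp]: "X \<in> vector_fields \<A>" "Y \<in> vector_fields \<A>"
  shows "g p (D X (D X \<xi>) p) (Y p) - g p (h p (D X X p)) (Y p) =
    curvature \<A> g nabla p (X p) (Y p) (X p) (\<xi> p)"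
proof -
  have "(\<lambda>q. g q (D Y \<xi> q) (X q)) = (\<lambda>q. - g q (Y q) (D X \<xi> q))"
    by (simp add: D_xi h_skew)
  then have "X p (\<lambda>q. g q (D Y \<xi> q) (X q)) = X p (\<lambda>q. - g q (Y q) (D X \<xi> q))"
    by (simp only:)
  also have "\<dots> = - X p (\<lambda>q. g q (Y q) (D X \<xi> q))"
    by (rule vector_field_minus[OF _ g_smooth]) simp_all
  finally have 1: "g p (D X (D Y \<xi>) p) (X p) + g p (D Y \<xi> p) (D X X p) =
      - (g p (D X Y p) (D X \<xi> p) + g p (Y p) (D X (D X \<xi>) p))"
    by (simp add: D_metric)
  have "g q (D X \<xi> q) (X q) = 0" for q
    using h_skew[of "X q" q "X q"] g_sym[of "X q" q "h q (X q)"] by (simp add: D_xi)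
  then have "Y p (\<lambda>q. g q (D X \<xi> q) (X q)) = 0"
    by (simp add: vector_field_const)
  then have 2: "g p (D Y (D X \<xi>) p) (X p) + g p (D X \<xi> p) (D Y X p) = 0"
    by (simp add: D_metric)
  have "curvature \<A> g nabla p (X p) (Y p) (\<xi> p) (X p) =
      g p (D X (D Y \<xi>) p) (X p) - g p (D Y (D X \<xi>) p) (X p) - g p (D (lie_bracket X Y) \<xi> p) (X p)"
    by (simp add: curvature_eq curvature_field_eq g_diff lie_bracket_vector_field)
  moreover have "D (lie_bracket X Y) \<xi> p = h p (D X Y p) - h p (D Y X p)"
    by (simp add: D_xi lie_bracket_eq nabla_diff_left)
  ultimately have "curvature \<A> g nabla p (X p) (Y p) (\<xi> p) (X p) =
      g p (h p (D X X p)) (Y p) - g p (Y p) (D X (D X \<xi>) p)"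
    using 1 2 h_skew[of "D X X p" p "Y p"] h_skew[of "D X Y p" p "X p"] h_skew[of "D Y X p" p "X p"]
      g_sym[of "D X X p" p "h p (Y p)"] g_sym[of "D Y X p" p "h p (X p)"]
    by (simp add: D_xi[of _ p] g_linear)
  then show ?thesis
    using curvature_metric[of "X p" p "Y p" "\<xi> p" "X p"] g_sym[of "Y p" p "D X (D X \<xi>) p"] by simp
qed

text \<open>The field version of \<open>P\<close>. As \<open>P\<close> chooses a new extension at
  every point, this closed form is what shows smoothness and permits a further
  differentiation.\<close>

definition N :: "'a vfield \<Rightarrow> 'a vfield \<Rightarrow> 'a vfield" where
  "N X Y = D X (Th Y) - Th (D X Y)"

lemma N_vector_field: "\<lbrakk>X \<in> vector_fields \<A>; Y \<in> vector_fields \<A>\<rbrakk> \<Longrightarrow> N X Y \<in> vector_fields \<A>"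
  by (simp add: N_def)

lemma N_eq: "\<lbrakk>X \<in> vector_fields \<A>; Y \<in> vector_fields \<A>\<rbrakk> \<Longrightarrow> N X Y q = P q (X q) (Y q)"
  by (simp add: N_def D_def nabla_endo_eq)

lemma D_theta: "\<lbrakk>X \<in> vector_fields \<A>; Y \<in> vector_fields \<A>\<rbrakk> \<Longrightarrow> D X (Th Y) = N X Y + Th (D X Y)"
  by (simp add: N_def)

text \<open>The Ricci identity: since \<open>\<nabla>\<theta>\<close> is skew in its two vector arguments, only the second covariant
  derivative of \<open>\<theta>\<close> along \<open>X, X\<close> survives, and the right-hand side is minus its value at \<open>Y\<close>.\<close>

lemma curvature_theta_commutator:
  assumes X [simp]: "X \<in> vector_fields \<A>" and Y [simp]: "Y \<in> vector_fields \<A>"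
  shows "curvature_field nabla X Y (Th X) p - \<theta> p (curvature_field nabla X Y X p) =
    P p (D X X p) (Y p) + P p (X p) (D X Y p) - D X (N X Y) p"
proof -
  note [simp] = N_vector_field lie_bracket_vector_field
  have D_Th: "D U (Th V) p = P p (U p) (V p) + \<theta> p (D U V p)"
    if "U \<in> vector_fields \<A>" "V \<in> vector_fields \<A>" for U V
    using that by (simp add: D_theta N_eq)
  have "D Y (Th X) = Th (D Y X) - N X Y"
  proof
    show "D Y (Th X) q = (Th (D Y X) - N X Y) q" for q
      using P_swap[of "Y q" q "X q"] by (simp add: D_theta N_eq)
  qed
  then have "D X (D Y (Th X)) p = P p (X p) (D Y X p) + \<theta> p (D X (D Y X) p) - D X (N X Y) p"
    by (simp add: D_diff_right D_Th)
  \<comment> \<open>Since \<open>P\<close> vanishes on equal arguments, this order of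
    differentiation produces no derivative of \<open>P\<close>.\<close>
  moreover have "D X (Th X) = Th (D X X)"
    by (rule ext) (simp add: D_theta N_eq P_self)
  then have "D Y (D X (Th X)) p = P p (Y p) (D X X p) + \<theta> p (D Y (D X X) p)"
    by (simp add: D_Th)
  moreover have "D (lie_bracket X Y) (Th X) p =
      P p (D X Y p) (X p) - P p (D Y X p) (X p) + \<theta> p (D (lie_bracket X Y) X p)"
    by (simp add: D_Th) (simp add: lie_bracket_eq P_diff_left)
  moreover have "P p (Y p) (D X X p) = - P p (D X X p) (Y p)" "P p (D X Y p) (X p) = - P p (X p) (D X Y p)"
      "P p (D Y X p) (X p) = - P p (X p) (D Y X p)"
    by (rule P_swap; simp)+
  ultimately show ?thesis
    by (simp add: curvature_field_eq theta_diff)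
qed

text \<open>The vectors \<open>?a\<close> and \<open>?b\<close> depend on the extensions and must
  drop out. The polarized \<open>g_P_theta\<close> removes \<open>?a\<close>;
  \<open>second_derivative_xi\<close> combines \<open>?b\<close> with the second derivative of \<xi>
  into the curvature term by which g(\<theta>U, \<theta>y) differs from g(U, y).\<close>

lemma curvature_theta_last_two:
  assumes x: "x \<in> tangent_space \<A> p" and y: "y \<in> tangent_space \<A> p"
  shows "curvature \<A> g nabla p x y x y - curvature \<A> g nabla p x y (\<theta> p x) (\<theta> p y) =
    - g p (P p x y) (P p x y) - (g p (h p x) y)\<^sup>2"
proof -
  define X Y where XY: "X = extend \<A> p x" "Y = extend \<A> p y"
  have [simp]: "X \<in> vector_fields \<A>" "Y \<in> vector_fields \<A>" "X p = x" "Y p = y"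
    using x y by (simp_all add: XY)
  note [simp] = x y N_vector_field
  let ?K = "curvature \<A> g nabla p"
  let ?a = "D X Y p" and ?b = "D X X p"
  \<comment> \<open>An identity of functions, so that its derivative along X evaluates the product
    of \<open>D X (N X Y)\<close> with \<theta>Y.\<close>
  have "(\<lambda>q. g q (N X Y q) (Th Y q)) = (\<lambda>q. - (g q (Y q) (\<xi> q) * g q (Y q) (D X \<xi> q)))"
  proof
    show "g q (N X Y q) (Th Y q) = - (g q (Y q) (\<xi> q) * g q (Y q) (D X \<xi> q))" for q
      using g_P_theta[of "X q" q "Y q" "Y q"] by (simp add: N_eq D_xi)
  qed
  then have "X p (\<lambda>q. g q (N X Y q) (Th Y q)) = X p (\<lambda>q. - (g q (Y q) (\<xi> q) * g q (Y q) (D X \<xi> q)))"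
    by (simp only:)
  also have "\<dots> = - X p (\<lambda>q. g q (Y q) (\<xi> q) * g q (Y q) (D X \<xi> q))"
    by (rule vector_field_minus[OF _ smooth_functions_mult[OF g_smooth g_smooth]]) simp_all
  also have "X p (\<lambda>q. g q (Y q) (\<xi> q) * g q (Y q) (D X \<xi> q)) =
      g p (Y p) (\<xi> p) * X p (\<lambda>q. g q (Y q) (D X \<xi> q)) + X p (\<lambda>q. g q (Y q) (\<xi> q)) * g p (Y p) (D X \<xi> p)"
    by (rule vector_field_mult[OF _ g_smooth g_smooth]) simp_all
  finally have 1: "g p (D X (N X Y) p) (\<theta> p y) + g p (P p x y) (P p x y + \<theta> p ?a) =
      - (g p y (\<xi> p) * (g p ?a (h p x) + g p y (D X (D X \<xi>) p))
        + (g p ?a (\<xi> p) + g p y (h p x)) * g p y (h p x))"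
    using D_metric[of X "N X Y" "Th Y" p] D_metric[of X Y "D X \<xi>" p] D_metric[of X Y \<xi> p]
    by (simp add: D_theta N_eq D_xi)
  have "?K x y (\<theta> p x) (\<theta> p y) - g p (\<theta> p (curvature_field nabla X Y X p)) (\<theta> p y) =
      g p (P p ?b y) (\<theta> p y) + g p (P p x ?a) (\<theta> p y) - g p (D X (N X Y) p) (\<theta> p y)"
    using curvature_theta_commutator[of X Y p] curvature_eq[of X Y "Th X" p "\<theta> p y"]
    by (simp flip: g_diff g_add)
  moreover have "g p (\<theta> p (curvature_field nabla X Y X p)) (\<theta> p y) = ?K x y x y - ?K x y x (\<xi> p) * g p y (\<xi> p)"
    using curvature_eq[of X Y X p y] curvature_eq[of X Y X p "\<xi> p"] by (simp add: g_theta_theta)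
  moreover have "g p (P p ?b y) (\<theta> p y) = - g p y (\<xi> p) * g p y (h p ?b)"
    using g_P_theta[of ?b p y y] by simp
  moreover have "g p (P p x ?a) (\<theta> p y) + g p (P p x y) (\<theta> p ?a) =
      - g p y (\<xi> p) * g p ?a (h p x) - g p ?a (\<xi> p) * g p y (h p x)"
    using g_P_theta[of x p y ?a] by simp
  moreover have "?K x y x (\<xi> p) = g p y (D X (D X \<xi>) p) - g p y (h p ?b)"
    using second_derivative_xi[of X Y p] g_sym[of y p "D X (D X \<xi>) p"] g_sym[of y p "h p ?b"] by simp
  ultimately show ?thesis
    using 1 g_sym[of "h p x" p y] by (simp add: g_linear power2_eq_square algebra_simps)
qed

text \<open>\<open>theta_P\<close> moves \<theta> out of the second slot, and after
  \<open>P_swap\<close> also out of the first. The multiples of \<xi> produced by the two moves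
  cancel because h is skew and anticommutes with \<theta>.\<close>

lemma P_theta_theta:
  assumes [simp]: "x \<in> tangent_space \<A> p" "y \<in> tangent_space \<A> p"
  shows "P p (\<theta> p x) (\<theta> p y) =
    scale (g p x (\<xi> p)) (\<theta> p (h p y)) - scale (g p y (\<xi> p)) (\<theta> p (h p x)) - P p x y"
proof -
  have "P p (\<theta> p x) y = \<theta> p (P p y x) - (scale (g p x (h p y)) (\<xi> p) + scale (g p x (\<xi> p)) (h p y))"
    using P_swap[of "\<theta> p x" p y] by (simp add: theta_P)
  then have "\<theta> p (P p (\<theta> p x) y) =
      scale (g p (P p y x) (\<xi> p)) (\<xi> p) - P p y x - scale (g p x (\<xi> p)) (\<theta> p (h p y))"
    by (simp add: theta_diff theta_add theta_scale theta_theta theta_xi tvec_scale_zero_right)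
  moreover have "g p (P p y x) (\<xi> p) = g p y (h p (\<theta> p x))"
    using h_skew[of y p "\<theta> p x"] by (simp add: g_P_xi theta_skew g_sym[of x p "\<theta> p (h p y)"] h_theta g_linear)
  moreover have "P p y x = - P p x y"
    by (rule P_swap) simp_all
  ultimately show ?thesis
    using theta_P[of "\<theta> p x" p y]
    by (simp add: h_theta fun_eq_iff scale_apply)
qed

text \<open>Here the terms of T originate. In \<open>curvature_theta_last_two\<close> at (x,y) and
  at (\<theta>x,\<theta>y) the mixed curvatures agree, by pair symmetry, up to the \<xi>-part of
  \<theta>^2, which yields the two curvature terms. The rest of T is |P(\<theta>x,\<theta>y)|^2 -
  |P(x,y)|^2, while the squares of g(hx, y) cancel.\<close>

lemma curvature_theta_difference:
  assumes [simp]: "x \<in> tangent_space \<A> p" "y \<in> tangent_space \<A> p"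
  shows "curvature \<A> g nabla p x y x y - curvature \<A> g nabla p (\<theta> p x) (\<theta> p y) (\<theta> p x) (\<theta> p y) =
    expr_T \<A> g \<theta> \<xi> nabla p x y"
proof -
  let ?K = "curvature \<A> g nabla p" and ?a = "g p x (\<xi> p)" and ?b = "g p y (\<xi> p)" and ?V = "P p x y"
  have "?K u v r (scale c s - t) = c * ?K u v r s - ?K u v r t"
    if "u \<in> tangent_space \<A> p" "v \<in> tangent_space \<A> p" "r \<in> tangent_space \<A> p"
      "s \<in> tangent_space \<A> p" "t \<in> tangent_space \<A> p" for u v r s t c
    using that by (simp add: curvature_extend g_linear)
  note right = this
  have third: "?K u v (scale c s - t) r = c * ?K u v s r - ?K u v t r"
    if [simp]: "u \<in> tangent_space \<A> p" "v \<in> tangent_space \<A> p" "r \<in> tangent_space \<A> p"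
      "s \<in> tangent_space \<A> p" "t \<in> tangent_space \<A> p" for u v r s t c
    using right[of u v r s t c] curvature_metric[of u p v "scale c s - t" r]
      curvature_metric[of u p v s r] curvature_metric[of u p v t r] by simp
  have "?K (\<theta> p x) (\<theta> p y) (\<xi> p) (\<xi> p) = 0"
    using curvature_metric[of "\<theta> p x" p "\<theta> p y" "\<xi> p" "\<xi> p"] by simp
  then have "?K (\<theta> p x) (\<theta> p y) (\<theta> p (\<theta> p x)) (\<theta> p (\<theta> p y)) = ?K x y (\<theta> p x) (\<theta> p y)
      - ?b * ?K (\<theta> p x) (\<theta> p y) x (\<xi> p) + ?a * ?K (\<theta> p x) (\<theta> p y) y (\<xi> p)"
    using curvature_metric[of "\<theta> p x" p "\<theta> p y" "\<xi> p" y] curvature_pair[of "\<theta> p x" p "\<theta> p y" x y]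
    by (simp add: theta_theta right third)
  moreover have "g p (P p (\<theta> p x) (\<theta> p y)) (P p (\<theta> p x) (\<theta> p y)) = g p ?V ?V
      + ?b\<^sup>2 * g p (h p x) (h p x) + ?a\<^sup>2 * g p (h p y) (h p y) - 2 * ?a * ?b * g p (h p x) (h p y)
      - 2 * ?b * g p (\<theta> p ?V) (h p x) + 2 * ?a * g p (\<theta> p ?V) (h p y)"
    by (simp add: P_theta_theta g_linear g_theta_theta g_h_xi theta_skew[of ?V]
        g_sym[of "\<theta> p (h p x)" p ?V] g_sym[of "\<theta> p (h p y)" p ?V] g_sym[of "h p y" p "h p x"]
        power2_eq_square algebra_simps)
  moreover have "g p (h p (\<theta> p x)) (\<theta> p y) = - g p (h p x) y"
    by (simp add: h_theta g_linear g_theta_theta g_h_xi)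
  ultimately show ?thesis
    using curvature_theta_last_two[of x p y] curvature_theta_last_two[of "\<theta> p x" p "\<theta> p y"]
    unfolding expr_T_def by simp
qed

end

theorem proposition3p2:
  fixes \<A> :: "('a::{t2_space, second_countable_topology}, 'e::euclidean_space) chart set"
    and g :: "'a \<Rightarrow> 'a tvec \<Rightarrow> 'a tvec \<Rightarrow> real"
    and \<theta> :: "'a \<Rightarrow> 'a tvec \<Rightarrow> 'a tvec"
    and \<xi> :: "'a vfield"
    and \<eta> :: "'a \<Rightarrow> 'a tvec \<Rightarrow> real"
    and nabla :: "'a \<Rightarrow> 'a tvec \<Rightarrow> 'a vfield \<Rightarrow> 'a tvec"
    and n :: nat and p :: 'a and w x y z :: "'a tvec"
  assumes "nearly_cosymplectic_manifold \<A> g \<theta> \<xi> \<eta> nabla"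
    and "DIM('e) = 2 * n + 1"
    and "w \<in> tangent_space \<A> p" and "x \<in> tangent_space \<A> p"
    and "y \<in> tangent_space \<A> p" and "z \<in> tangent_space \<A> p"
  shows "curvature \<A> g nabla p w x y z
       - curvature \<A> g nabla p (\<theta> p w) (\<theta> p x) (\<theta> p y) (\<theta> p z)
     = 1/3 * (expr_A (expr_T \<A> g \<theta> \<xi> nabla p) w x y z
            - expr_B (expr_T \<A> g \<theta> \<xi> nabla p) w x y z)"
proof -
  interpret nearly_cosymplectic_manifold \<A> g \<theta> \<xi> \<eta> nabla
    by (rule assms(1))
  let ?R = "curvature \<A> g nabla p" and ?t = "\<theta> p"
  let ?K = "\<lambda>a b c d. ?R a b c d - ?R (?t a) (?t b) (?t c) (?t d)"
  have "expr_A (expr_T \<A> g \<theta> \<xi> nabla p) w x y z - expr_B (expr_T \<A> g \<theta> \<xi> nabla p) w x y z = 3 * ?K w x y z"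
  proof (rule polarization[where V = "tangent_space \<A> p" and K = ?K])
    fix a b c d
    assume [simp]: "a \<in> tangent_space \<A> p" "b \<in> tangent_space \<A> p" "c \<in> tangent_space \<A> p" "d \<in> tangent_space \<A> p"
    show "?K a b c d = - ?K b a c d"
      using curvature_swap[of a p b c d] curvature_swap[of "?t a" p "?t b" "?t c" "?t d"] by simp
    show "?K a b c d = ?K c d a b"
      using curvature_pair[of a p b c d] curvature_pair[of "?t a" p "?t b" "?t c" "?t d"] by simp
    show "?K a b c d + ?K b c a d + ?K c a b d = 0"
      using curvature_Bianchi[of a p b c d] curvature_Bianchi[of "?t a" p "?t b" "?t c" "?t d"] by simp
  qed (use assms(3-6) in \<open>simp_all add: curvature_theta_difference theta_add curvature_add_left\<close>)
  then show ?thesis by simp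
qed

end
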